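(* Let $\alpha\ge1$ be real. There exists a constant $a_\alpha>0$ such that for every integer $k\ne0$ and every $f_k^{in}\in H^1$, the solution $f_k$ of $$\partial_tf_k+ikr^\alpha f_k=0,\quad r\in[0,1),\ t\ge0,\qquad f_k(0)=f_k^{in},$$ satisfies $$\|f_k(t)\|_{H^{-1}}\le\frac{a_\alpha}{(1+|k|t)^{p_\alpha}}\,\|f_k^{in}\|_{H^1},\qquad\forall t\ge0,$$ where $$p_\alpha=\frac{2}{\max\{\alpha,2\}},$$ and $a_\alpha$ is independent of $k$, $t$ and $f_k^{in}$.
   Context: For fixed integer $k\ne0$, the spaces of functions $\phi:[0,1)\to\mathbb{C}$ are: $H$ with norm $\|\phi\|_H^2=\int_0^1|\phi(r)|^2r\,dr$; $H^1=H^1_k$ with norm $\|\phi\|_{H^1}^2=\int_0^1\left[|\partial_r\phi(r)|^2+\frac{k^2}{r^2}|\phi(r)|^2\right]r\,dr$; and the dual norm $\|\phi\|_{H^{-1}}=\sup_{\eta\in H^1,\,\|\eta\|_{H^1}=1}\left|\int_0^1\phi(r)\overline{\eta(r)}\,r\,dr\right|$ (the $H^1$ and $H^{-1}$ norms depend on $k$). The equation is the $k$-th angular Fourier mode, in polar coordinates on the unit disk, of the transport equation $\partial_tf+\boldsymbol{u}\cdot\nabla f=0$ with $\boldsymbol{u}(r,\theta)=r^{1+\alpha}(-\sin\theta,\cos\theta)$. *)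

theory Defs
  imports "HOL-Analysis.Analysis"
begin

text \<open>
  Radial functions are total functions \<open>real \<Rightarrow> complex\<close> of which only the values on
  \<open>{0..<1}\<close> matter, up to Lebesgue-null sets. Measurability is Lebesgue measurability, so that
  it is invariant under modification on null sets.
\<close>

definition test_function :: "(real \<Rightarrow> real) \<Rightarrow> bool" where
  "test_function \<psi> \<longleftrightarrow> \<psi> C1_differentiable_on UNIV \<and>
     (\<exists>a b. 0 < a \<and> b < 1 \<and> (\<forall>x. x \<notin> {a..b} \<longrightarrow> \<psi> x = 0))"

definition locally_integrable :: "(real \<Rightarrow> complex) \<Rightarrow> bool" where
  "locally_integrable \<phi> \<longleftrightarrow> (\<forall>a b. 0 < a \<longrightarrow> b < 1 \<longrightarrow> set_integrable lebesgue {a..b} \<phi>)"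

text \<open>
  The derivative with respect to \<open>r\<close> is the weak one on the open interval \<open>{0<..<1}\<close>, tested
  against compactly supported functions of class \<open>C\<^sup>1\<close> as is usual for Sobolev spaces on an
  interval. It is unique up to null sets, hence the choice in \<open>weak_deriv\<close> is immaterial.
\<close>

definition has_weak_deriv :: "(real \<Rightarrow> complex) \<Rightarrow> (real \<Rightarrow> complex) \<Rightarrow> bool" where
  "has_weak_deriv \<phi> g \<longleftrightarrow> locally_integrable \<phi> \<and> locally_integrable g \<and>
     (\<forall>\<psi>. test_function \<psi> \<longrightarrow>
        (LINT r:{0<..<1}|lebesgue. deriv \<psi> r *\<^sub>R \<phi> r)
          = - (LINT r:{0<..<1}|lebesgue. \<psi> r *\<^sub>R g r))"

definition weak_deriv :: "(real \<Rightarrow> complex) \<Rightarrow> real \<Rightarrow> complex" where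
  "weak_deriv \<phi> = (SOME g. has_weak_deriv \<phi> g)"

definition H1_density :: "int \<Rightarrow> (real \<Rightarrow> complex) \<Rightarrow> real \<Rightarrow> real" where
  "H1_density k \<phi> r =
     ((cmod (weak_deriv \<phi> r))\<^sup>2 + (of_int k)\<^sup>2 / r\<^sup>2 * (cmod (\<phi> r))\<^sup>2) * r"

definition H1 :: "int \<Rightarrow> (real \<Rightarrow> complex) set" where
  "H1 k = {\<phi>. (\<exists>g. has_weak_deriv \<phi> g) \<and> set_integrable lebesgue {0..<1} (H1_density k \<phi>)}"

definition H1_norm :: "int \<Rightarrow> (real \<Rightarrow> complex) \<Rightarrow> real" where
  "H1_norm k \<phi> = sqrt (LINT r:{0..<1}|lebesgue. H1_density k \<phi> r)"

text \<open>
  The supremum is taken in \<open>ennreal\<close>, where it always exists; a bound by a real number thus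
  includes finiteness. The pairing is an absolutely convergent integral whenever \<open>\<phi>\<close> is
  square integrable with respect to \<open>r dr\<close>, in particular when \<open>\<phi>\<close> has the same modulus
  almost everywhere as an element of \<open>H1 k\<close>.
\<close>

definition Hm1_norm :: "int \<Rightarrow> (real \<Rightarrow> complex) \<Rightarrow> ennreal" where
  "Hm1_norm k \<phi> = (SUP \<eta>\<in>{\<eta>\<in>H1 k. H1_norm k \<eta> = 1}.
     ennreal (cmod (LINT r:{0..<1}|lebesgue. \<phi> r * cnj (\<eta> r) * of_real r)))"

text \<open>
  The argument order is \<open>f t r\<close>. There is no derivative in \<open>r\<close>, so the equation is an ordinary
  differential equation in \<open>t\<close> (one-sided at \<open>t = 0\<close>), required for almost every \<open>r\<close>.
\<close>

definition transport_solution ::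
  "real \<Rightarrow> int \<Rightarrow> (real \<Rightarrow> complex) \<Rightarrow> (real \<Rightarrow> real \<Rightarrow> complex) \<Rightarrow> bool" where
  "transport_solution \<alpha> k f_in f \<longleftrightarrow>
     (AE r\<in>{0..<1} in lebesgue. f 0 r = f_in r \<and>
        (\<forall>t\<ge>0. \<exists>D. ((\<lambda>s. f s r) has_vector_derivative D) (at t within {0..}) \<and>
                   D + \<i> * of_int k * of_real (r powr \<alpha>) * f t r = 0))"

text \<open>Solutions exist and are unique up to null sets.\<close>

lemma transport_solution_exists:
  "transport_solution \<alpha> k f_in
     (\<lambda>t r. exp (- (\<i> * of_int k * of_real (r powr \<alpha>) * of_real t)) * f_in r)"
  unfolding transport_solution_def
proof (intro AE_I2 impI conjI allI)
  fix r t :: real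
  let ?c = "\<i> * of_int k * of_real (r powr \<alpha>) :: complex"
  have "((\<lambda>s. exp (- (?c * of_real s)) * f_in r) has_vector_derivative
           - ?c * (exp (- (?c * of_real t)) * f_in r)) (at t within {0..})"
    by (auto intro!: derivative_eq_intros has_vector_derivative_real_field)
  then show "\<exists>D. ((\<lambda>s. exp (- (?c * of_real s)) * f_in r) has_vector_derivative D)
          (at t within {0..}) \<and> D + ?c * (exp (- (?c * of_real t)) * f_in r) = 0"
    by (intro exI conjI) (assumption, simp)
qed simp

lemma transport_solution_unique:
  assumes "transport_solution \<alpha> k f_in f"
  shows "AE r\<in>{0..<1} in lebesgue. \<forall>t\<ge>0.
           f t r = exp (- (\<i> * of_int k * of_real (r powr \<alpha>) * of_real t)) * f_in r"
  using assms unfolding transport_solution_def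
proof (rule AE_mp, intro AE_I2 impI allI)
  fix r t :: real
  let ?c = "\<i> * of_int k * of_real (r powr \<alpha>) :: complex"
  assume "r \<in> {0..<1} \<longrightarrow> f 0 r = f_in r \<and>
        (\<forall>t\<ge>0. \<exists>D. ((\<lambda>s. f s r) has_vector_derivative D) (at t within {0..}) \<and>
                   D + ?c * f t r = 0)" and "r \<in> {0..<1}" and t: "0 \<le> t"
  then have f0: "f 0 r = f_in r"
    and "\<And>t. 0 \<le> t \<Longrightarrow> ((\<lambda>s. f s r) has_vector_derivative - (?c * f t r)) (at t within {0..})"
    by (auto simp: add_eq_0_iff2)
  then have D: "((\<lambda>s. f s r) has_vector_derivative - (?c * f t r)) (at t within {0..})"
    if "0 \<le> t" for t using that by blast
  have E: "((\<lambda>s. exp (?c * of_real s)) has_vector_derivative ?c * exp (?c * of_real s))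
     (at s within {0..})" for s :: real
    by (auto intro!: derivative_eq_intros has_vector_derivative_real_field)
  have "((\<lambda>s. exp (?c * of_real s) * f s r) has_vector_derivative 0) (at s within {0..})"
    if "s \<in> {0..}" for s
    using has_vector_derivative_mult[OF E D, of s] that by (simp add: algebra_simps)
  then obtain c where c: "\<And>s. s \<in> {0..} \<Longrightarrow> exp (?c * of_real s) * f s r = c"
    using has_vector_derivative_zero_constant[of "{0..}" "\<lambda>s. exp (?c * of_real s) * f s r"]
    by auto
  have "exp (?c * of_real t) * f t r = f_in r"
    using c[of t] c[of 0] t f0 by simp
  then show "f t r = exp (- (?c * of_real t)) * f_in r"
    by (metis exp_minus_inverse mult.commute mult.left_commute mult.right_neutral)
qed

end

theory Submission
  imports Defs
begin

text \<open>
  Write the solution as \<open>f t r = exp (- \<i> k t r\<^sup>\<alpha>) f_in r\<close> and put \<open>h = f_in * cnj \<eta>\<close>. With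
  \<open>D\<close> the geometric mean of the two \<open>H1\<close> densities, \<open>|h| \<le> r D\<close> and \<open>|h'| \<le> 2 D\<close>, while the
  integral of \<open>D\<close> is at most the product of the \<open>H1\<close> norms. Hence the part of the pairing over
  \<open>r < \<delta>\<close> is at most \<open>\<delta>\<^sup>2\<close> times that product; on \<open>r > \<delta>\<close> one integrates by parts once against
  the phase, which gains \<open>1 / (|k| t)\<close> and loses \<open>max 1 (\<delta>\<^sup>2\<^sup>-\<^sup>\<alpha>)\<close>. The choice
  \<open>\<delta> = (|k| t) powr (- 1 / max \<alpha> 2)\<close> gives the rate. The integration by parts requires absolutely
  continuous representatives of weakly differentiable functions (du Bois-Reymond) and a product
  rule for them, which is Fubini's theorem on a square.
\<close>

section \<open>Absolutely continuous functions as indefinite Lebesgue integrals\<close>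

text \<open>Lets Fubini's theorem be applied to \<open>lebesgue\<close> itself: a countable cover by
  sets of finite \<open>lborel\<close> measure keeps its measures in the completion.\<close>

lemma sigma_finite_lebesgue: "sigma_finite_measure (lebesgue :: real measure)"
proof -
  obtain A where A: "countable A" "A \<subseteq> sets lborel" "\<Union>A = (space lborel :: real set)"
    "\<forall>a\<in>A. emeasure lborel a \<noteq> \<infinity>"
    using lborel.sigma_finite_countable by blast
  show ?thesis
    by standard (use A in \<open>auto intro!: exI[of _ A]\<close>)
qed

interpretation leb: pair_sigma_finite "lebesgue :: real measure" "lebesgue :: real measure"
  using sigma_finite_lebesgue by (simp add: pair_sigma_finite_def)

lemma integrable_lebesgue_times_pair:
  fixes f g :: "real \<Rightarrow> complex"
  assumes f[measurable]: "integrable lebesgue f" and g[measurable]: "integrable lebesgue g"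
    and S[measurable]: "S \<in> sets (lebesgue \<Otimes>\<^sub>M lebesgue)"
  shows "integrable (lebesgue \<Otimes>\<^sub>M lebesgue) (\<lambda>(x, y). indicator S (x, y) *\<^sub>R (f x * g y))"
proof -
  have "integrable (lebesgue \<Otimes>\<^sub>M lebesgue) (\<lambda>(x, y). f x * g y)"
  proof (rule leb.Fubini_integrable)
    show "integrable lebesgue (\<lambda>x. LINT y|lebesgue. norm (case (x, y) of (x, y) \<Rightarrow> f x * g y))"
      using f by (simp add: norm_mult)
  qed (use g in \<open>auto\<close>)
  from integrable_mult_indicator[OF S this] show ?thesis
    by (simp add: case_prod_unfold)
qed

lemma lebesgue_le_pair:
  "{(x, y). x < y} \<in> sets (lebesgue \<Otimes>\<^sub>M (lebesgue :: real measure))"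
  "{(x, y). y \<le> x} \<in> sets (lebesgue \<Otimes>\<^sub>M (lebesgue :: real measure))"
proof -
  have id: "(\<lambda>x. x) \<in> lebesgue \<rightarrow>\<^sub>M (borel :: real measure)"
    by (rule id_borel_measurable_lebesgue[unfolded id_def])
  have [measurable]: "fst \<in> lebesgue \<Otimes>\<^sub>M lebesgue \<rightarrow>\<^sub>M (borel :: real measure)"
    "snd \<in> lebesgue \<Otimes>\<^sub>M lebesgue \<rightarrow>\<^sub>M (borel :: real measure)"
    using measurable_compose[OF measurable_fst id] measurable_compose[OF measurable_snd id] by auto
  have "{p \<in> space (lebesgue \<Otimes>\<^sub>M lebesgue). fst p < (snd p :: real)} \<in> sets (lebesgue \<Otimes>\<^sub>M lebesgue)"
    "{p \<in> space (lebesgue \<Otimes>\<^sub>M lebesgue). snd p \<le> (fst p :: real)} \<in> sets (lebesgue \<Otimes>\<^sub>M lebesgue)"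
    by measurable
  then show
    "{(x, y). x < y} \<in> sets (lebesgue \<Otimes>\<^sub>M (lebesgue :: real measure))"
    "{(x, y). y \<le> x} \<in> sets (lebesgue \<Otimes>\<^sub>M (lebesgue :: real measure))"
    by (simp_all add: space_pair_measure case_prod_unfold)
qed

text \<open>Integration by parts in Fubini form. The plane is split along the diagonal; integrating
  \<open>f x * g y\<close> over the half \<open>y \<le> x\<close> in \<open>x\<close> first gives
  one summand, over the half \<open>x < y\<close> in \<open>y\<close> first the other, and together
  they give the full product integral.\<close>

lemma lebesgue_integral_tail_product:
  fixes f g :: "real \<Rightarrow> complex"
  assumes f: "integrable lebesgue f" and g: "integrable lebesgue g"
  shows "integrable lebesgue (\<lambda>y. g y * (LINT x:{y..}|lebesgue. f x))"
    and "(LINT y|lebesgue. g y * (LINT x:{y..}|lebesgue. f x))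
       + (LINT x|lebesgue. f x * (LINT y:{x..}|lebesgue. g y))
     = (LINT x|lebesgue. f x) * (LINT y|lebesgue. g y)"
proof -
  let ?ge = "\<lambda>x y. indicator {(x, y). y \<le> x} (x, y) *\<^sub>R (f x * g y)"
  let ?lt = "\<lambda>x y. indicator {(x, y). x < y} (x, y) *\<^sub>R (f x * g y)"
  note i1 = integrable_lebesgue_times_pair[OF f g lebesgue_le_pair(2)]
  note i2 = integrable_lebesgue_times_pair[OF f g lebesgue_le_pair(1)]
  have inner: "(LINT x|lebesgue. ?ge x y) = g y * (LINT x:{y..}|lebesgue. f x)" for y
  proof -
    have "(LINT x|lebesgue. ?ge x y) = (LINT x|lebesgue. g y * (indicator {y..} x *\<^sub>R f x))"
      by (intro Bochner_Integration.integral_cong) (auto simp: indicator_def)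
    also have "\<dots> = g y * (LINT x:{y..}|lebesgue. f x)"
      by (simp only: set_lebesgue_integral_def integral_mult_right_zero)
    finally show ?thesis .
  qed
  have inner2: "(LINT y|lebesgue. ?lt x y) = f x * (LINT y:{x..}|lebesgue. g y)" for x
  proof -
    have "(LINT y|lebesgue. ?lt x y) = (LINT y|lebesgue. f x * (indicator {x<..} y *\<^sub>R g y))"
      by (intro Bochner_Integration.integral_cong) (auto simp: indicator_def)
    also have "\<dots> = f x * (LINT y:{x<..}|lebesgue. g y)"
      by (simp only: set_lebesgue_integral_def integral_mult_right_zero)
    \<comment> \<open>The strict half plane yields an open tail; closing it adds one point, which is
      null.\<close>
    also have "(LINT y:{x<..}|lebesgue. g y) = (LINT y:{x..}|lebesgue. g y)"
      by (rule set_integral_discrete_difference[of "{x}"]) auto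
    finally show ?thesis .
  qed
  show "integrable lebesgue (\<lambda>y. g y * (LINT x:{y..}|lebesgue. f x))"
    using leb.integrable_snd[OF i1] by (simp only: inner)
  have "(LINT y|lebesgue. g y * (LINT x:{y..}|lebesgue. f x)) = (LINT y|lebesgue. LINT x|lebesgue. ?ge x y)"
    by (simp only: inner)
  also have "\<dots> = (LINT x|lebesgue. LINT y|lebesgue. ?ge x y)"
    by (rule leb.Fubini_integral[OF i1])
  finally have "(LINT y|lebesgue. g y * (LINT x:{y..}|lebesgue. f x))
      + (LINT x|lebesgue. f x * (LINT y:{x..}|lebesgue. g y))
    = (LINT x|lebesgue. LINT y|lebesgue. ?ge x y) + (LINT x|lebesgue. LINT y|lebesgue. ?lt x y)"
    by (simp only: inner2)
  also have "\<dots> = (LINT x|lebesgue. (LINT y|lebesgue. ?ge x y) + (LINT y|lebesgue. ?lt x y))"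
    using leb.integrable_fst[OF i1] leb.integrable_fst[OF i2]
    by (intro Bochner_Integration.integral_add[symmetric]) auto
  also have "\<dots> = (LINT x|lebesgue. LINT y|lebesgue. f x * g y)"
  proof (intro Bochner_Integration.integral_cong refl)
    fix x :: real
    have "integrable lebesgue (\<lambda>y. indicator {..x} y *\<^sub>R (f x * g y))"
      "integrable lebesgue (\<lambda>y. indicator {x<..} y *\<^sub>R (f x * g y))"
      using g by (auto intro!: integrable_mult_indicator)
    then have "integrable lebesgue (?ge x)" "integrable lebesgue (?lt x)"
      by (simp_all add: indicator_def)
    then have "(LINT y|lebesgue. ?ge x y) + (LINT y|lebesgue. ?lt x y) = (LINT y|lebesgue. ?ge x y + ?lt x y)"
      by (rule Bochner_Integration.integral_add[symmetric])
    also have "\<dots> = (LINT y|lebesgue. f x * g y)"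
      by (intro Bochner_Integration.integral_cong) (auto simp: indicator_def)
    finally show "(LINT y|lebesgue. ?ge x y) + (LINT y|lebesgue. ?lt x y) = (LINT y|lebesgue. f x * g y)" .
  qed
  finally show "(LINT y|lebesgue. g y * (LINT x:{y..}|lebesgue. f x))
       + (LINT x|lebesgue. f x * (LINT y:{x..}|lebesgue. g y))
     = (LINT x|lebesgue. f x) * (LINT y|lebesgue. g y)"
    by simp
qed

text \<open>
  Integrals are normalised at the right endpoint \<open>1\<close>: elements of \<open>H1 k\<close> have a derivative that
  is integrable up to \<open>1\<close>, but possibly not near \<open>0\<close>.
\<close>

definition AC_from :: "real \<Rightarrow> (real \<Rightarrow> complex) \<Rightarrow> (real \<Rightarrow> complex) \<Rightarrow> bool" where
  "AC_from a F f \<longleftrightarrow> set_integrable lebesgue {a..1} f \<and>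
     (\<forall>r\<in>{a..1}. F r = F 1 - (LINT x:{r..1}|lebesgue. f x))"

section \<open>Calculus of absolutely continuous functions\<close>

lemma AC_from_set_integrable: "AC_from a F f \<Longrightarrow> set_integrable lebesgue {a..1} f"
  by (simp add: AC_from_def)

lemma AC_from_integral:
  "AC_from a F f \<Longrightarrow> a \<le> r \<Longrightarrow> r \<le> 1 \<Longrightarrow> (LINT x:{r..1}|lebesgue. f x) = F 1 - F r"
proof -
  assume "AC_from a F f" "a \<le> r" "r \<le> 1"
  then have "F r = F 1 - (LINT x:{r..1}|lebesgue. f x)"
    unfolding AC_from_def by (meson atLeastAtMost_iff)
  then show ?thesis by algebra
qed

lemma AC_from_continuous:
  assumes "AC_from a F f"
  shows "continuous_on {a..1} F"
proof -
  have f: "set_integrable lebesgue {a..1} f" using assms by (simp add: AC_from_def)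
  have cont: "continuous_on {a..1} (\<lambda>r. F 1 - integral {r..1} f)"
    by (intro continuous_intros indefinite_integral_continuous_1' set_lebesgue_integral_eq_integral f)
  have "F r = F 1 - integral {r..1} f" if "r \<in> {a..1}" for r
  proof -
    have "set_integrable lebesgue {r..1} f"
      using that by (intro set_integrable_subset[OF f]) auto
    then have "(LINT x:{r..1}|lebesgue. f x) = integral {r..1} f"
      by (rule set_lebesgue_integral_eq_integral(2))
    moreover have "(LINT x:{r..1}|lebesgue. f x) = F 1 - F r"
      using assms that by (intro AC_from_integral) auto
    ultimately have "integral {r..1} f = F 1 - F r" by simp
    then show ?thesis by simp
  qed
  then show ?thesis by (intro continuous_on_eq[OF cont]) (rule sym)
qed

lemma set_integrable_continuous_mult:
  fixes f F :: "real \<Rightarrow> complex"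
  assumes "continuous_on {a..b} F" "set_integrable lebesgue {a..b} f"
  shows "set_integrable lebesgue {a..b} (\<lambda>x. F x * f x)"
  using assms
  by (intro absolutely_integrable_bounded_measurable_product[of "(*)"])
     (auto intro!: bilinear_times continuous_imp_measurable_on_sets_lebesgue compact_imp_bounded
        compact_continuous_image)

text \<open>Fubini on the square over \<open>{r..1}\<close>: with \<open>f\<close> and
  \<open>g\<close> cut off to \<open>{r..1}\<close>, the tails in
  \<open>lebesgue_integral_tail_product\<close> become \<open>F 1 - F y\<close> and
  \<open>G 1 - G y\<close>. The right-hand side there is \<open>(F 1 - F r) * (G 1 - G r)\<close>,
  and expanding everything leaves the increment of the product.\<close>

lemma AC_from_mult:
  assumes F: "AC_from a F f" and G: "AC_from a G g"
  shows "AC_from a (\<lambda>r. F r * G r) (\<lambda>r. F r * g r + f r * G r)"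
  unfolding AC_from_def
proof (intro conjI ballI)
  have f: "set_integrable lebesgue {a..1} f" and g: "set_integrable lebesgue {a..1} g"
    using F G by (auto simp: AC_from_def)
  have Fg: "set_integrable lebesgue {a..1} (\<lambda>r. F r * g r)"
    by (rule set_integrable_continuous_mult[OF AC_from_continuous[OF F] g])
  have fG: "set_integrable lebesgue {a..1} (\<lambda>r. f r * G r)"
    using set_integrable_continuous_mult[OF AC_from_continuous[OF G] f] by (simp add: mult.commute)
  show "set_integrable lebesgue {a..1} (\<lambda>r. F r * g r + f r * G r)"
    using Fg fG by (rule set_integral_add)
  fix r assume r: "r \<in> {a..1}"
  have sub: "set_integrable lebesgue {r..1} h" if "set_integrable lebesgue {a..1} h" for h :: "real \<Rightarrow> complex"
    using that r by (rule_tac set_integrable_subset) auto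
  define f' g' where "f' = (\<lambda>x. indicator {r..1} x *\<^sub>R f x)" and "g' = (\<lambda>x. indicator {r..1} x *\<^sub>R g x)"
  have f': "integrable lebesgue f'" and g': "integrable lebesgue g'"
    using sub[OF f] sub[OF g] by (simp_all add: f'_def g'_def set_integrable_def)
  have tail: "(LINT x:{y..}|lebesgue. indicator {r..1} x *\<^sub>R h x) = (LINT x:{y..1}|lebesgue. h x)"
    if "y \<in> {r..1}" for y and h :: "real \<Rightarrow> complex"
  proof -
    have "indicator {y..} x *\<^sub>R indicator {r..1} x *\<^sub>R h x = indicator {y..1} x *\<^sub>R h x" for x
      using that by (simp add: indicator_def)
    then show ?thesis by (simp only: set_lebesgue_integral_def)
  qed
  have Ff: "(LINT x:{y..}|lebesgue. f' x) = F 1 - F y" if "y \<in> {r..1}" for y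
    unfolding f'_def tail[OF that] using F that r by (intro AC_from_integral) auto
  have Gg: "(LINT x:{y..}|lebesgue. g' x) = G 1 - G y" if "y \<in> {r..1}" for y
    unfolding g'_def tail[OF that] using G that r by (intro AC_from_integral) auto
  have "(LINT y:{r..1}|lebesgue. g y * (F 1 - F y)) + (LINT x:{r..1}|lebesgue. f x * (G 1 - G x))
      = (LINT x:{r..1}|lebesgue. f x) * (LINT x:{r..1}|lebesgue. g x)"
  proof -
    have "(LINT y:{r..1}|lebesgue. g y * (F 1 - F y)) = (LINT y|lebesgue. g' y * (LINT x:{y..}|lebesgue. f' x))"
      unfolding set_lebesgue_integral_def[of _ "{r..1}"]
      by (intro Bochner_Integration.integral_cong) (auto simp: Ff g'_def indicator_def)
    moreover have "(LINT y:{r..1}|lebesgue. f y * (G 1 - G y)) = (LINT y|lebesgue. f' y * (LINT x:{y..}|lebesgue. g' x))"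
      unfolding set_lebesgue_integral_def[of _ "{r..1}"]
      by (intro Bochner_Integration.integral_cong) (auto simp: Gg f'_def indicator_def)
    ultimately show ?thesis
      using lebesgue_integral_tail_product(2)[OF f' g']
      by (simp add: f'_def g'_def set_lebesgue_integral_def)
  qed
  moreover have "(LINT y:{r..1}|lebesgue. g y * (F 1 - F y))
      = F 1 * (LINT y:{r..1}|lebesgue. g y) - (LINT y:{r..1}|lebesgue. F y * g y)"
    using sub[OF g] sub[OF Fg]
    by (subst set_integral_mult_right[symmetric], subst set_integral_diff(2)[symmetric])
       (auto simp: algebra_simps)
  moreover have "(LINT y:{r..1}|lebesgue. f y * (G 1 - G y))
      = G 1 * (LINT y:{r..1}|lebesgue. f y) - (LINT y:{r..1}|lebesgue. f y * G y)"
    using sub[OF f] sub[OF fG]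
    by (subst set_integral_mult_right[symmetric], subst set_integral_diff(2)[symmetric])
       (auto simp: algebra_simps)
  moreover have "(LINT x:{r..1}|lebesgue. f x) = F 1 - F r" "(LINT x:{r..1}|lebesgue. g x) = G 1 - G r"
    using F G r by (auto intro!: AC_from_integral)
  moreover have "(LINT x:{r..1}|lebesgue. F x * g x + f x * G x)
      = (LINT y:{r..1}|lebesgue. F y * g y) + (LINT y:{r..1}|lebesgue. f y * G y)"
    by (rule set_integral_add(2)[OF sub[OF Fg] sub[OF fG]])
  ultimately show "F r * G r = F 1 * G 1 - (LINT x:{r..1}|lebesgue. F x * g x + f x * G x)"
    by algebra
qed

lemma AC_from_cnj:
  assumes "AC_from a F f"
  shows "AC_from a (\<lambda>r. cnj (F r)) (\<lambda>r. cnj (f r))"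
proof -
  have cnj: "(LINT x:{r..1}|lebesgue. cnj (f x)) = cnj (LINT x:{r..1}|lebesgue. f x)" for r
    using Bochner_Integration.integral_cnj[of lebesgue "\<lambda>x. indicator {r..1} x *\<^sub>R f x"]
    by (simp only: set_lebesgue_integral_def complex_cnj_scaleR)
  have "set_integrable lebesgue {a..1} (\<lambda>x. cnj (f x))"
    using assms unfolding AC_from_def set_integrable_def
    by (subst complex_integrable_cnj[symmetric]) (simp only: complex_cnj_scaleR complex_cnj_cnj)
  moreover have "cnj (F r) = cnj (F 1) - cnj (LINT x:{r..1}|lebesgue. f x)" if "r \<in> {a..1}" for r
    using AC_from_integral[OF assms, of r] that by simp
  ultimately show ?thesis by (simp only: AC_from_def cnj) blast
qed

text \<open>Serves the two explicit smooth factors that meet the product rule: the test function of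
  the weak formulation and the kernel of the integration by parts against the phase.\<close>

lemma AC_from_C1:
  fixes K K' :: "real \<Rightarrow> complex"
  assumes "\<And>r. r \<in> {a..1} \<Longrightarrow> (K has_vector_derivative K' r) (at r within {a..1})"
    and K': "continuous_on {a..1} K'"
  shows "AC_from a K K'"
  unfolding AC_from_def
proof (intro conjI ballI)
  show i: "set_integrable lebesgue {a..1} K'"
    using K' by (rule absolutely_integrable_continuous_real)
  fix r assume r: "r \<in> {a..1}"
  have "(K' has_integral (K 1 - K r)) {r..1}"
    using r by (intro fundamental_theorem_of_calculus)
      (auto intro!: has_vector_derivative_within_subset[OF assms(1)])
  moreover have "set_integrable lebesgue {r..1} K'"
    using r by (intro set_integrable_subset[OF i]) auto
  ultimately show "K r = K 1 - (LINT x:{r..1}|lebesgue. K' x)"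
    by (simp add: set_lebesgue_integral_eq_integral(2) integral_unique)
qed

section \<open>Representatives of weakly differentiable functions\<close>

text \<open>Completeness of Lebesgue measure is at work: a change on a null set keeps measurability,
  so that of \<open>g\<close> is a consequence. This carries integrals from representatives over to
  functions known only almost everywhere.\<close>

lemma AE_lebesgue_cong_set_integral:
  fixes f g :: "real \<Rightarrow> 'b::euclidean_space"
  assumes f: "set_integrable lebesgue A f" and eq: "AE x\<in>A in lebesgue. f x = g x"
  shows "set_integrable lebesgue A g" and "(LINT x:A|lebesgue. f x) = (LINT x:A|lebesgue. g x)"
proof -
  obtain N where N: "N \<in> null_sets lebesgue" "{x. \<not> (x \<in> A \<longrightarrow> f x = g x)} \<subseteq> N"
    using eq by (auto simp: eventually_ae_filter)
  then have neg: "negligible N" by (simp add: negligible_iff_null_sets)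
  show g: "set_integrable lebesgue A g"
    by (rule absolutely_integrable_spike[OF f neg]) (use N in auto)
  then show "(LINT x:A|lebesgue. f x) = (LINT x:A|lebesgue. g x)"
    using f N
    by (simp only: set_lebesgue_integral_eq_integral(2), intro integral_spike[OF neg]) auto
qed

section \<open>Functions determined by their integrals over intervals\<close>

lemma set_lebesgue_integral_restrict:
  fixes f :: "'a \<Rightarrow> 'b::{banach, second_countable_topology}"
  assumes "A \<subseteq> B" and "\<And>x. x \<in> B - A \<Longrightarrow> f x = 0"
  shows "(LINT x:B|M. f x) = (LINT x:A|M. f x)"
proof -
  have "indicator B x *\<^sub>R f x = indicator A x *\<^sub>R f x" for x
    using assms by (cases "x \<in> A"; cases "x \<in> B") (auto simp: indicator_def)
  then show ?thesis by (simp only: set_lebesgue_integral_def)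
qed

text \<open>After extension by zero, the integral vanishes over every compact interval. Closure
  under complements and disjoint unions extends this to Borel sets, and adding null sets to all
  Lebesgue sets; a density whose integral over every measurable set is zero vanishes almost
  everywhere.\<close>

lemma AE_zero_if_integral_intervals_zero:
  fixes v :: "real \<Rightarrow> complex"
  assumes v: "set_integrable lebesgue {p..q} v"
    and zero: "\<And>c d. p \<le> c \<Longrightarrow> c \<le> d \<Longrightarrow> d \<le> q \<Longrightarrow> (LINT x:{c..d}|lebesgue. v x) = 0"
  shows "AE x\<in>{p..q} in lebesgue. v x = 0"
proof -
  define V where "V x = indicator {p..q} x *\<^sub>R v x" for x
  have V: "integrable lebesgue V" using v by (simp add: V_def[abs_def] set_integrable_def)
  have VS: "set_integrable lebesgue S V" if "S \<in> sets lebesgue" for S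
    using that V by (simp add: set_integrable_def integrable_mult_indicator)
  have int: "(LINT x:{a..b}|lebesgue. V x) = 0" for a b
  proof -
    have "indicator {a..b} x *\<^sub>R V x = indicator {max a p..min b q} x *\<^sub>R v x" for x
      by (simp add: V_def indicator_def)
    then have "(LINT x:{a..b}|lebesgue. V x) = (LINT x:{max a p..min b q}|lebesgue. v x)"
      by (simp only: set_lebesgue_integral_def)
    also have "\<dots> = 0"
    proof (cases "max a p \<le> min b q")
      case True
      then show ?thesis by (intro zero) auto
    next
      case False
      then have "{max a p..min b q} = {}" by simp
      then show ?thesis by (simp add: set_lebesgue_integral_def)
    qed
    finally show ?thesis .
  qed
  have UN: "(LINT x:UNIV|lebesgue. V x) = 0"
  proof -
    have "(LINT x:UNIV|lebesgue. V x) = (LINT x:{p..q}|lebesgue. V x)"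
      by (rule set_lebesgue_integral_restrict) (auto simp: V_def)
    then show ?thesis by (simp only: int)
  qed
  have bor: "(LINT x:S|lebesgue. V x) = 0" if "S \<in> sets borel" for S
    using that
  proof (induction rule: borel_set_induct)
    case (compl A)
    have "(LINT x:A \<union> - A|lebesgue. V x) = (LINT x:A|lebesgue. V x) + (LINT x:- A|lebesgue. V x)"
      using compl by (intro set_integral_Un VS) auto
    then show ?case using compl UN by simp
  next
    case (union f)
    have "(LINT x:(\<Union>i. f i)|lebesgue. V x) = (\<Sum>i. LINT x:f i|lebesgue. V x)"
      using union by (intro lebesgue_integral_countable_add VS) (auto simp: disjoint_family_on_def)
    then show ?case using union by simp
  qed (simp add: set_lebesgue_integral_def, rule int)
  have "(LINT x:A|lebesgue. V x) = 0" if A: "A \<in> sets lebesgue" for A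
  proof -
    obtain S N N' where N: "A = S \<union> N" "N \<subseteq> N'" "N' \<in> null_sets lborel" "S \<in> sets lborel"
      using sets_completionE[OF A] by metis
    have "AE x in lebesgue. x \<notin> N'"
      by (intro AE_not_in null_sets_completionI N)
    then have "AE x in lebesgue. x \<in> S \<longleftrightarrow> x \<in> A"
      by eventually_elim (use N in auto)
    moreover have "set_borel_measurable lebesgue S V" "set_borel_measurable lebesgue A V"
      using VS[of S] VS[of A] A N
      by (auto simp: set_integrable_def set_borel_measurable_def intro: borel_measurable_integrable)
    ultimately have "(LINT x:A|lebesgue. V x) = (LINT x:S|lebesgue. V x)"
      by (intro set_integral_cong_set) auto
    then show ?thesis using bor N by simp
  qed
  then have "AE x in lebesgue. V x = 0" by (rule sigma_finite_measure.density_zero[OF sigma_finite_lebesgue V])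
  then show ?thesis by eventually_elim (auto simp: V_def)
qed

text \<open>A continuous substitute for the indicator of \<open>{c<..<d}\<close>, with ramps of
  slope \<open>n\<close> and height at most 1. Continuity matters because only continuous functions
  are derivatives of test functions of class C1.\<close>

definition trapezoid :: "real \<Rightarrow> real \<Rightarrow> nat \<Rightarrow> real \<Rightarrow> real" where
  "trapezoid c d n x = min 1 (max 0 (real n * min (x - c) (d - x)))"

lemma trapezoid_continuous [continuous_intros]: "continuous_on S (trapezoid c d n)"
  unfolding trapezoid_def by (intro continuous_intros)

lemma trapezoid_eq_0:
  assumes "x \<notin> {c<..<d}"
  shows "trapezoid c d n x = 0"
proof -
  have "min (x - c) (d - x) \<le> 0" using assms by auto
  then have "real n * min (x - c) (d - x) \<le> 0"
    by (rule mult_nonneg_nonpos[OF of_nat_0_le_iff])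
  then show ?thesis by (simp add: trapezoid_def max_absorb1)
qed

lemma trapezoid_bounds: "0 \<le> trapezoid c d n x" "trapezoid c d n x \<le> 1"
  by (auto simp: trapezoid_def)

lemma trapezoid_tendsto: "(\<lambda>n. trapezoid c d n x) \<longlonglongrightarrow> indicator {c<..<d} x"
proof (cases "x \<in> {c<..<d}")
  case True
  define m where "m = min (x - c) (d - x)"
  have m: "0 < m" using True by (auto simp: m_def)
  obtain N :: nat where N: "1 / m < N" using reals_Archimedean2 by blast
  have "trapezoid c d n x = 1" if "n \<ge> N" for n
  proof -
    have "1 / m < real n" using N that by linarith
    then have "1 \<le> real n * m" using m by (simp add: field_simps)
    then show ?thesis by (simp add: trapezoid_def flip: m_def)
  qed
  then have "eventually (\<lambda>n. trapezoid c d n x = 1) sequentially"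
    by (auto simp: eventually_sequentially)
  then show ?thesis using True by (simp add: tendsto_eventually)
next
  case False
  then show ?thesis by (simp add: trapezoid_eq_0[OF False])
qed

lemma set_integrable_continuous_scaleR:
  fixes u :: "real \<Rightarrow> 'b::euclidean_space" and \<xi> :: "real \<Rightarrow> real"
  assumes "continuous_on {p..q} \<xi>" "set_integrable lebesgue {p..q} u"
  shows "set_integrable lebesgue {p..q} (\<lambda>x. \<xi> x *\<^sub>R u x)"
  using assms
  by (intro absolutely_integrable_bounded_measurable_product[of "(*\<^sub>R)"])
     (auto intro!: continuous_imp_measurable_on_sets_lebesgue compact_imp_bounded
        compact_continuous_image simp: bilinear_conv_bounded_bilinear bounded_bilinear_scaleR)

text \<open>Dominated convergence with majorant \<open>norm (u x)\<close> on \<open>{p..q}\<close>;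
  the limit is the integral over the open interval, and the two endpoints are null.\<close>

lemma trapezoid_integral_tendsto:
  fixes u :: "real \<Rightarrow> 'b::euclidean_space"
  assumes u: "set_integrable lebesgue {p..q} u" and "p \<le> c" "d \<le> q"
  shows "(\<lambda>n. LINT x:{p..q}|lebesgue. trapezoid c d n x *\<^sub>R u x) \<longlonglongrightarrow> (LINT x:{c..d}|lebesgue. u x)"
proof -
  have "(\<lambda>n. LINT x:{p..q}|lebesgue. trapezoid c d n x *\<^sub>R u x)
      \<longlonglongrightarrow> (LINT x|lebesgue. indicator {c<..<d} x *\<^sub>R u x)"
    unfolding set_lebesgue_integral_def
  proof (rule integral_dominated_convergence[where w = "\<lambda>x. norm (indicator {p..q} x *\<^sub>R u x)"])
    have "set_integrable lebesgue {c<..<d} u"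
      using assms by (intro set_integrable_subset[OF u]) auto
    then show "(\<lambda>x. indicator {c<..<d} x *\<^sub>R u x) \<in> borel_measurable lebesgue"
      unfolding set_integrable_def by (rule borel_measurable_integrable)
    show "(\<lambda>x. indicator {p..q} x *\<^sub>R trapezoid c d n x *\<^sub>R u x) \<in> borel_measurable lebesgue" for n
      using set_integrable_continuous_scaleR[OF trapezoid_continuous u, of c d n]
      unfolding set_integrable_def by (rule borel_measurable_integrable)
    show "integrable lebesgue (\<lambda>x. norm (indicator {p..q} x *\<^sub>R u x))"
      using u unfolding set_integrable_def by (rule integrable_norm)
    show "AE x in lebesgue. (\<lambda>n. indicator {p..q} x *\<^sub>R trapezoid c d n x *\<^sub>R u x)
        \<longlonglongrightarrow> indicator {c<..<d} x *\<^sub>R u x"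
    proof (rule AE_I2)
      fix x
      have "(\<lambda>n. indicator {p..q} x *\<^sub>R trapezoid c d n x *\<^sub>R u x)
          \<longlonglongrightarrow> indicator {p..q} x *\<^sub>R indicator {c<..<d} x *\<^sub>R u x"
        by (intro tendsto_intros trapezoid_tendsto)
      moreover have "indicator {p..q} x *\<^sub>R indicator {c<..<d} x *\<^sub>R u x = indicator {c<..<d} x *\<^sub>R u x"
        using assms by (auto simp: indicator_def)
      ultimately show "(\<lambda>n. indicator {p..q} x *\<^sub>R trapezoid c d n x *\<^sub>R u x)
          \<longlonglongrightarrow> indicator {c<..<d} x *\<^sub>R u x" by (simp only:)
    qed
    show "AE x in lebesgue. norm (indicator {p..q} x *\<^sub>R trapezoid c d n x *\<^sub>R u x)
        \<le> norm (indicator {p..q} x *\<^sub>R u x)" for n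
      using trapezoid_bounds[of c d n] by (intro AE_I2) (auto simp: indicator_def mult_left_le_one_le)
  qed
  also have "(LINT x|lebesgue. indicator {c<..<d} x *\<^sub>R u x) = (LINT x:{c..d}|lebesgue. u x)"
    unfolding set_lebesgue_integral_def[symmetric]
    by (rule set_integral_discrete_difference[of "{c, d}"]) auto
  finally show ?thesis .
qed

text \<open>Local integrability speaks only of compact subintervals of \<open>{0<..<1}\<close>; this
  exhaustion passes to the whole interval by countably many of them. The shift by 2 keeps each one
  nonempty and inside \<open>{0<..<1}\<close>.\<close>

lemma unit_interval_exhaustion:
  fixes x :: real
  assumes "x \<in> {0<..<1}"
  obtains N :: nat where "\<And>n. N \<le> n \<Longrightarrow> x \<in> {1 / (real n + 2)..1 - 1 / (real n + 2)}"
proof -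
  define e where "e = min x (1 - x)"
  have e: "0 < e" using assms by (auto simp: e_def)
  obtain N :: nat where N: "1 / e < N" using reals_Archimedean2 by blast
  have "x \<in> {1 / (real n + 2)..1 - 1 / (real n + 2)}" if "N \<le> n" for n
  proof -
    have "1 / e < real n" using N that by linarith
    then have "1 < real n * e" using e by (simp add: field_simps)
    then have "1 \<le> (real n + 2) * e" using e by (simp add: distrib_right)
    then have "1 / (real n + 2) \<le> e" by (simp add: field_simps)
    then show ?thesis by (auto simp: e_def)
  qed
  then show ?thesis by (rule that)
qed

text \<open>The du Bois-Reymond lemma. Orthogonality to a suitable combination of two trapezoids
  shows, in the limit, that \<open>u\<close> has the same mean \<open>m\<close> over any two
  intervals. Hence \<open>u - m\<close> integrates to zero over every interval and vanishes almost
  everywhere.\<close>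

lemma AE_constant_if_orthogonal:
  fixes u :: "real \<Rightarrow> complex"
  assumes u: "\<And>p q. 0 < p \<Longrightarrow> q < 1 \<Longrightarrow> set_integrable lebesgue {p..q} u"
    and orth: "\<And>\<xi> p q. continuous_on UNIV \<xi> \<Longrightarrow> 0 < p \<Longrightarrow> p \<le> q \<Longrightarrow> q < 1 \<Longrightarrow>
      (\<And>x. x \<notin> {p..q} \<Longrightarrow> \<xi> x = 0) \<Longrightarrow> (LINT x:{p..q}|lebesgue. \<xi> x) = (0 :: real) \<Longrightarrow>
      (LINT x:{p..q}|lebesgue. \<xi> x *\<^sub>R u x) = 0"
  shows "\<exists>c. AE x\<in>{0<..<1} in lebesgue. u x = c"
proof -
  have cross: "(d' - c') *\<^sub>R (LINT x:{c..d}|lebesgue. u x) = (d - c) *\<^sub>R (LINT x:{c'..d'}|lebesgue. u x)"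
    if cd: "0 < c" "c \<le> d" "d < 1" "0 < c'" "c' \<le> d'" "d' < 1" for c d c' d'
  proof -
    define p q where "p = min c c'" and "q = max d d'"
    have pq: "0 < p" "p \<le> q" "q < 1" "p \<le> c" "d \<le> q" "p \<le> c'" "d' \<le> q"
      using cd by (auto simp: p_def q_def)
    have one: "set_integrable lebesgue {p..q} (\<lambda>x. 1 :: real)"
      by (rule absolutely_integrable_continuous_real) auto
    note up = u[OF pq(1,3)]
    define A where "A n = (LINT x:{p..q}|lebesgue. trapezoid c d n x)" for n
    define B where "B n = (LINT x:{p..q}|lebesgue. trapezoid c' d' n x)" for n
    define I where "I n = (LINT x:{p..q}|lebesgue. trapezoid c d n x *\<^sub>R u x)" for n
    define J where "J n = (LINT x:{p..q}|lebesgue. trapezoid c' d' n x *\<^sub>R u x)" for n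
    have T: "set_integrable lebesgue {p..q} (trapezoid a b n)" for a b n
      by (rule absolutely_integrable_continuous_real) (rule trapezoid_continuous)
    have Tu: "set_integrable lebesgue {p..q} (\<lambda>x. trapezoid a b n x *\<^sub>R u x)" for a b n
      by (rule set_integrable_continuous_scaleR[OF trapezoid_continuous up])
    have len: "(LINT x:{a..b}|lebesgue. 1 :: real) = b - a" if "a \<le> b" for a b :: real
      using that by (simp add: set_lebesgue_integral_def)
    have A: "A \<longlonglongrightarrow> d - c" and B: "B \<longlonglongrightarrow> d' - c'"
      using trapezoid_integral_tendsto[OF one pq(4,5)] trapezoid_integral_tendsto[OF one pq(6,7)]
        cd len by (simp_all add: A_def[abs_def] B_def[abs_def])
    have I: "I \<longlonglongrightarrow> (LINT x:{c..d}|lebesgue. u x)" and J: "J \<longlonglongrightarrow> (LINT x:{c'..d'}|lebesgue. u x)"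
      using trapezoid_integral_tendsto[OF up pq(4,5)] trapezoid_integral_tendsto[OF up pq(6,7)]
      by (simp_all add: I_def[abs_def] J_def[abs_def])
    have "B n *\<^sub>R I n = A n *\<^sub>R J n" for n
    proof -
      \<comment> \<open>The crossed weights cancel the mean: \<open>A n\<close> and
        \<open>B n\<close> are the masses of the two trapezoids, so the integral is
        \<open>B n * A n - A n * B n\<close>.\<close>
      let ?\<xi> = "\<lambda>x. B n * trapezoid c d n x - A n * trapezoid c' d' n x"
      have "(LINT x:{p..q}|lebesgue. ?\<xi> x *\<^sub>R u x) = 0"
      proof (rule orth[OF _ pq(1-3)])
        show "continuous_on UNIV ?\<xi>" by (intro continuous_intros)
        show "?\<xi> x = 0" if "x \<notin> {p..q}" for x
        proof -
          have "x \<notin> {c<..<d}" "x \<notin> {c'<..<d'}" using that pq by auto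
          then show ?thesis by (simp add: trapezoid_eq_0)
        qed
        have "(LINT x:{p..q}|lebesgue. ?\<xi> x) = B n * A n - A n * B n"
          using T by (subst set_integral_diff(2)) (auto simp: A_def B_def)
        then show "(LINT x:{p..q}|lebesgue. ?\<xi> x) = 0" by simp
      qed
      moreover have "(LINT x:{p..q}|lebesgue. ?\<xi> x *\<^sub>R u x)
          = (LINT x:{p..q}|lebesgue. B n *\<^sub>R (trapezoid c d n x *\<^sub>R u x) - A n *\<^sub>R (trapezoid c' d' n x *\<^sub>R u x))"
        by (simp add: scaleR_diff_left)
      moreover have "\<dots> = B n *\<^sub>R I n - A n *\<^sub>R J n"
        using Tu by (subst set_integral_diff(2)) (auto simp: I_def J_def simp del: scaleR_scaleR)
      ultimately show ?thesis by simp
    qed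
    moreover have "(\<lambda>n. B n *\<^sub>R I n) \<longlonglongrightarrow> (d' - c') *\<^sub>R (LINT x:{c..d}|lebesgue. u x)"
      by (intro tendsto_intros B I)
    moreover have "(\<lambda>n. A n *\<^sub>R J n) \<longlonglongrightarrow> (d - c) *\<^sub>R (LINT x:{c'..d'}|lebesgue. u x)"
      by (intro tendsto_intros A J)
    ultimately show ?thesis by (simp add: LIMSEQ_unique)
  qed
  \<comment> \<open>The mean of \<open>u\<close> over a reference interval; the factor 2 is the
    inverse of its length.\<close>
  define m where "m = 2 *\<^sub>R (LINT x:{1/4..3/4}|lebesgue. u x)"
  have mean: "(LINT x:{c..d}|lebesgue. u x) = (d - c) *\<^sub>R m" if "0 < c" "c \<le> d" "d < 1" for c d
    using cross[OF that, of "1/4" "3/4"] by (simp add: m_def scaleR_conv_of_real field_simps)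
  have ae: "AE x\<in>{p..q} in lebesgue. u x - m = 0" if pq: "0 < p" "q < 1" for p q
  proof (rule AE_zero_if_integral_intervals_zero)
    have const: "set_integrable lebesgue {c..d} (\<lambda>x. m)" for c d :: real
      by (rule absolutely_integrable_continuous_real) auto
    show "set_integrable lebesgue {p..q} (\<lambda>x. u x - m)"
      by (intro set_integral_diff u pq const)
    fix c d assume cd: "p \<le> c" "c \<le> d" "d \<le> q"
    then have "(LINT x:{c..d}|lebesgue. u x - m) = (d - c) *\<^sub>R m - (LINT x:{c..d}|lebesgue. m)"
      using pq u const by (subst set_integral_diff(2)) (auto simp: mean)
    also have "(LINT x:{c..d}|lebesgue. m) = (d - c) *\<^sub>R m"
      using cd by (subst set_integral_const) auto
    finally show "(LINT x:{c..d}|lebesgue. u x - m) = 0" by simp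
  qed
  have "AE x in lebesgue. \<forall>n::nat. x \<in> {1 / (real n + 2)..1 - 1 / (real n + 2)} \<longrightarrow> u x - m = 0"
    unfolding AE_all_countable by (intro allI ae) auto
  then have "AE x\<in>{0<..<1} in lebesgue. u x = m"
  proof eventually_elim
    case (elim x)
    show ?case
    proof
      assume x: "x \<in> {0<..<1}"
      then obtain n :: nat where "x \<in> {1 / (real n + 2)..1 - 1 / (real n + 2)}"
        using unit_interval_exhaustion by blast
      with elim show "u x = m" by fastforce
    qed
  qed
  then show ?thesis by blast
qed

text \<open>The primitive that starts left of the support of \<open>\<xi>\<close> vanishes to the
  right of the support exactly because \<open>\<xi>\<close> has mean zero. Thus every continuous
  compactly supported function of mean zero is available as \<open>deriv \<psi>\<close> in the weak
  formulation.\<close>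

lemma test_function_antiderivative:
  fixes \<xi> :: "real \<Rightarrow> real"
  assumes cont: "continuous_on UNIV \<xi>" and pq: "0 < p" "p \<le> q" "q < 1"
    and supp: "\<And>x. x \<notin> {p..q} \<Longrightarrow> \<xi> x = 0" and zero: "(LINT x:{p..q}|lebesgue. \<xi> x) = 0"
  obtains \<psi> where "test_function \<psi>" "\<And>x. (\<psi> has_real_derivative \<xi> x) (at x)"
    "\<And>x. x \<notin> {p..q} \<Longrightarrow> \<psi> x = 0"
proof -
  \<comment> \<open>Starting at \<open>p - 1\<close> instead of \<open>p\<close> makes each point of
    \<open>{p..q}\<close> interior to \<open>{p - 1..q + 1}\<close>, so that the derivative there is
    two-sided.\<close>
  define \<psi> where "\<psi> x = integral {p - 1..x} \<xi>" for x
  have cont': "continuous_on S \<xi>" for S using cont by (rule continuous_on_subset) simp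
  have int: "\<xi> integrable_on {a..b}" for a b
    by (rule integrable_continuous_real[OF cont'])
  have left: "\<psi> x = 0" if "x < p" for x
  proof -
    have "integral {p - 1..x} \<xi> = integral {p - 1..x} (\<lambda>x. 0)"
      by (rule integral_cong) (use that supp in auto)
    then show ?thesis by (simp add: \<psi>_def)
  qed
  have right: "\<psi> x = 0" if "q < x" for x
  proof -
    have "\<psi> x = integral {p - 1..p} \<xi> + (integral {p..q} \<xi> + integral {q..x} \<xi>)"
      using that pq by (simp add: \<psi>_def Henstock_Kurzweil_Integration.integral_combine int)
    moreover have "integral {p - 1..p} \<xi> = integral {p - 1..p} (\<lambda>x. 0)"
      by (rule integral_spike[of "{p}"]) (use supp in auto)
    moreover have "integral {q..x} \<xi> = integral {q..x} (\<lambda>x. 0)"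
      by (rule integral_spike[of "{q}"]) (use supp in auto)
    moreover have "integral {p..q} \<xi> = 0"
      using zero set_lebesgue_integral_eq_integral(2)[OF absolutely_integrable_continuous_real[OF cont']]
      by metis
    ultimately show ?thesis by simp
  qed
  have out: "\<psi> x = 0" if "x \<notin> {p..q}" for x using left right that by force
  have der: "(\<psi> has_real_derivative \<xi> x) (at x)" for x
  proof (cases "x \<in> {p..q}")
    case True
    then have "(\<psi> has_real_derivative \<xi> x) (at x within {p - 1..q + 1})"
      unfolding \<psi>_def by (intro integral_has_real_derivative cont') auto
    then show ?thesis using True by (simp add: at_within_Icc_at)
  next
    case False
    have "((\<lambda>x. 0) has_real_derivative \<xi> x) (at x)" using supp[OF False] by simp
    then show ?thesis
      by (rule has_field_derivative_transform_within_open[where S = "- {p..q}"])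
         (use False out in auto)
  qed
  have "\<psi> C1_differentiable_on UNIV"
    unfolding C1_differentiable_on_def using der cont
    by (auto simp: has_real_derivative_iff_has_vector_derivative)
  then have "test_function \<psi>"
    unfolding test_function_def using out pq by blast
  then show ?thesis using der out that by blast
qed

text \<open>Compare \<open>\<phi>\<close> with the primitive \<open>G\<close> of \<open>g\<close>
  that vanishes at 1. For a test function \<open>\<psi>\<close> with derivative
  \<open>\<xi>\<close>, the weak formulation for \<open>\<phi>\<close> and the product rule for
  \<open>\<psi> * G\<close> give the same value when \<open>\<xi>\<close> is paired with
  \<open>\<phi>\<close> and with \<open>G\<close>. So \<open>\<phi> - G\<close> is orthogonal to
  every \<open>\<xi>\<close> of mean zero, hence constant.\<close>

lemma weak_deriv_AC_representative:
  assumes \<phi>: "has_weak_deriv \<phi> g"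
    and g: "\<And>a. 0 < a \<Longrightarrow> set_integrable lebesgue {a..1} g"
  obtains F where "\<And>a. 0 < a \<Longrightarrow> AC_from a F g" "AE r\<in>{0<..<1} in lebesgue. \<phi> r = F r"
proof -
  define G where "G r = - (LINT x:{r..1}|lebesgue. g x)" for r
  have "(LINT x:{1..1}|lebesgue. g x) = (LINT x:{}|lebesgue. g x)"
    by (rule set_integral_discrete_difference[of "{1}"]) auto
  then have G1: "G 1 = 0" by (simp add: G_def set_lebesgue_integral_def)
  have G: "AC_from a G g" if "0 < a" for a
    using g[OF that] G1 unfolding AC_from_def by (simp add: G_def)
  have loc: "set_integrable lebesgue {p..q} \<phi>" if "0 < p" "q < 1" for p q
    using \<phi> that by (simp add: has_weak_deriv_def locally_integrable_def)
  have Gloc: "set_integrable lebesgue {p..q} G" if "0 < p" "q < 1" for p q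
    using that AC_from_continuous[OF G[of p]]
    by (intro absolutely_integrable_continuous_real) (auto intro: continuous_on_subset)
  have "\<exists>c. AE r\<in>{0<..<1} in lebesgue. \<phi> r - G r = c"
  proof (rule AE_constant_if_orthogonal)
    show "set_integrable lebesgue {p..q} (\<lambda>r. \<phi> r - G r)" if "0 < p" "q < 1" for p q
      by (intro set_integral_diff loc Gloc that)
    fix \<xi> :: "real \<Rightarrow> real" and p q
    assume cont: "continuous_on UNIV \<xi>" and pq: "0 < p" "p \<le> q" "q < 1"
      and supp: "\<And>x. x \<notin> {p..q} \<Longrightarrow> \<xi> x = 0" and zero: "(LINT x:{p..q}|lebesgue. \<xi> x) = 0"
    obtain \<psi> where \<psi>: "test_function \<psi>" "\<And>x. (\<psi> has_real_derivative \<xi> x) (at x)"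
      "\<And>x. x \<notin> {p..q} \<Longrightarrow> \<psi> x = 0"
      using test_function_antiderivative[OF cont pq supp zero] by metis
    have cont': "continuous_on S \<xi>" for S using cont by (rule continuous_on_subset) simp
    have \<psi>c: "continuous_on S \<psi>" for S
      using \<psi>(2) by (auto intro!: continuous_at_imp_continuous_on DERIV_isCont)
    have "(LINT r:{0<..<1}|lebesgue. deriv \<psi> r *\<^sub>R \<phi> r) = - (LINT r:{0<..<1}|lebesgue. \<psi> r *\<^sub>R g r)"
      using \<phi> \<psi>(1) by (simp add: has_weak_deriv_def)
    moreover have "deriv \<psi> = \<xi>" using \<psi>(2) by (auto intro: DERIV_imp_deriv)
    moreover have "(LINT r:{0<..<1}|lebesgue. \<xi> r *\<^sub>R \<phi> r) = (LINT r:{p..q}|lebesgue. \<xi> r *\<^sub>R \<phi> r)"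
      by (rule set_lebesgue_integral_restrict) (use pq supp in auto)
    moreover have "(LINT r:{0<..<1}|lebesgue. \<psi> r *\<^sub>R g r) = (LINT r:{p..q}|lebesgue. \<psi> r *\<^sub>R g r)"
      by (rule set_lebesgue_integral_restrict) (use pq \<psi>(3) in auto)
    ultimately have weak: "(LINT r:{p..q}|lebesgue. \<xi> r *\<^sub>R \<phi> r) = - (LINT r:{p..q}|lebesgue. \<psi> r *\<^sub>R g r)"
      by simp
    have "AC_from (p / 2) (\<lambda>r. of_real (\<psi> r)) (\<lambda>r. of_real (\<xi> r))"
    proof (rule AC_from_C1)
      show "((\<lambda>r. complex_of_real (\<psi> r)) has_vector_derivative complex_of_real (\<xi> r)) (at r within {p / 2..1})" for r
        using \<psi>(2)[of r]
        by (intro has_vector_derivative_of_real)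
           (auto simp: has_real_derivative_iff_has_vector_derivative intro: has_vector_derivative_at_within)
    qed (intro continuous_intros cont')
    \<comment> \<open>Both boundary terms vanish: \<open>G 1 = 0\<close> at the right end, and
      \<open>\<psi>\<close> is zero at \<open>p / 2\<close>, which lies left of its support but is
      still positive, as \<open>G\<close> requires.\<close>
    from AC_from_integral[OF AC_from_mult[OF this G], where r = "p / 2"]
    have "(LINT r:{p / 2..1}|lebesgue. of_real (\<psi> r) * g r + of_real (\<xi> r) * G r) = 0"
      using pq G1 \<psi>(3)[of "p / 2"] by simp
    also have "(LINT r:{p / 2..1}|lebesgue. of_real (\<psi> r) * g r + of_real (\<xi> r) * G r)
        = (LINT r:{p..q}|lebesgue. of_real (\<psi> r) * g r + of_real (\<xi> r) * G r)"
      by (rule set_lebesgue_integral_restrict) (use pq \<psi>(3) supp in auto)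
    finally have prod: "(LINT r:{p..q}|lebesgue. \<psi> r *\<^sub>R g r + \<xi> r *\<^sub>R G r) = 0"
      by (simp add: scaleR_conv_of_real)
    have gpq: "set_integrable lebesgue {p..q} g"
      using \<phi> pq by (simp add: has_weak_deriv_def locally_integrable_def)
    have i: "set_integrable lebesgue {p..q} (\<lambda>r. \<psi> r *\<^sub>R g r)"
      "set_integrable lebesgue {p..q} (\<lambda>r. \<xi> r *\<^sub>R G r)"
      "set_integrable lebesgue {p..q} (\<lambda>r. \<xi> r *\<^sub>R \<phi> r)"
      using pq by (auto intro!: set_integrable_continuous_scaleR cont' \<psi>c gpq Gloc loc)
    have "(LINT r:{p..q}|lebesgue. \<xi> r *\<^sub>R (\<phi> r - G r))
        = (LINT r:{p..q}|lebesgue. \<xi> r *\<^sub>R \<phi> r) - (LINT r:{p..q}|lebesgue. \<xi> r *\<^sub>R G r)"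
      unfolding scaleR_diff_right by (rule set_integral_diff(2)[OF i(3,2)])
    also have "\<dots> = - (LINT r:{p..q}|lebesgue. \<psi> r *\<^sub>R g r + \<xi> r *\<^sub>R G r)"
      unfolding weak by (subst set_integral_add(2)[OF i(1,2)]) simp
    finally show "(LINT r:{p..q}|lebesgue. \<xi> r *\<^sub>R (\<phi> r - G r)) = 0"
      unfolding prod by simp
  qed
  then obtain c where c: "AE r\<in>{0<..<1} in lebesgue. \<phi> r - G r = c" by blast
  show ?thesis
  proof (rule that)
    show "AC_from a (\<lambda>r. G r + c) g" if "0 < a" for a
      using g[OF that] G1 unfolding AC_from_def by (simp add: G_def)
    show "AE r\<in>{0<..<1} in lebesgue. \<phi> r = G r + c"
      using c by eventually_elim auto
  qed
qed

section \<open>Radial Sobolev functions\<close>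

text \<open>Integrability follows from the inequality of arithmetic and geometric means; the bound
  is the Cauchy-Schwarz inequality for nonnegative extended integrals of \<open>sqrt (P x)\<close>
  and \<open>sqrt (Q x)\<close>, brought back to the reals.\<close>

lemma Cauchy_Schwarz_sqrt_integral:
  fixes P Q :: "'a \<Rightarrow> real"
  assumes P: "integrable M P" and Q: "integrable M Q"
    and nonneg: "\<And>x. 0 \<le> P x" "\<And>x. 0 \<le> Q x"
  shows "integrable M (\<lambda>x. sqrt (P x * Q x))"
    and "(LINT x|M. sqrt (P x * Q x)) \<le> sqrt (LINT x|M. P x) * sqrt (LINT x|M. Q x)"
proof -
  have [measurable]: "P \<in> borel_measurable M" "Q \<in> borel_measurable M"
    using P Q by auto
  show int: "integrable M (\<lambda>x. sqrt (P x * Q x))"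
  proof (rule Bochner_Integration.integrable_bound)
    show "integrable M (\<lambda>x. P x + Q x)" using P Q by simp
    have "sqrt (P x * Q x) \<le> P x + Q x" for x
      using arith_geo_mean_sqrt[OF nonneg(1)[of x] nonneg(2)[of x]] nonneg[of x] by simp
    then show "AE x in M. norm (sqrt (P x * Q x)) \<le> norm (P x + Q x)"
      using nonneg by (intro AE_I2) simp
  qed simp
  define L A B where "L = (LINT x|M. sqrt (P x * Q x))" and "A = (LINT x|M. P x)" and "B = (LINT x|M. Q x)"
  have pos: "0 \<le> L" "0 \<le> A" "0 \<le> B"
    using nonneg by (simp_all add: L_def A_def B_def)
  have sq: "ennreal (sqrt y) ^ 2 = ennreal y" if "0 \<le> y" for y
    using that by (simp add: ennreal_power)
  have L: "(\<integral>\<^sup>+ x. ennreal (sqrt (P x)) * ennreal (sqrt (Q x)) \<partial>M) = ennreal L"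
    using nn_integral_eq_integral[OF int] nonneg
    by (simp add: L_def real_sqrt_mult ennreal_mult)
  have "(\<integral>\<^sup>+ x. ennreal (sqrt (P x)) * ennreal (sqrt (Q x)) \<partial>M)\<^sup>2
      \<le> (\<integral>\<^sup>+ x. ennreal (sqrt (P x)) ^ 2 \<partial>M) * (\<integral>\<^sup>+ x. ennreal (sqrt (Q x)) ^ 2 \<partial>M)"
    by (rule Cauchy_Schwarz_nn_integral) measurable
  also have "\<dots> = ennreal A * ennreal B"
    using nonneg by (simp only: sq nn_integral_eq_integral[OF P] nn_integral_eq_integral[OF Q] A_def B_def AE_I2)
  finally have "ennreal (L\<^sup>2) \<le> ennreal (A * B)"
    using pos by (simp only: L ennreal_power ennreal_mult)
  then have "L\<^sup>2 \<le> A * B" using pos by (simp add: ennreal_le_iff)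
  then have "L \<le> sqrt (A * B)" by (rule real_le_rsqrt)
  then show "(LINT x|M. sqrt (P x * Q x)) \<le> sqrt (LINT x|M. P x) * sqrt (LINT x|M. Q x)"
    by (simp add: L_def A_def B_def real_sqrt_mult)
qed

text \<open>The cutoffs to the compact intervals of the exhaustion are integrable, hence measurable,
  and converge pointwise.\<close>

lemma locally_integrable_measurable:
  assumes "locally_integrable \<phi>"
  shows "set_borel_measurable lebesgue {0<..<1} \<phi>"
  unfolding set_borel_measurable_def
proof (rule borel_measurable_LIMSEQ_metric)
  let ?S = "\<lambda>n::nat. {1 / (real n + 2)..1 - 1 / (real n + 2)}"
  show "(\<lambda>x. indicator (?S n) x *\<^sub>R \<phi> x) \<in> borel_measurable lebesgue" for n
    using assms unfolding locally_integrable_def set_integrable_def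
    by (intro borel_measurable_integrable) auto
  fix x :: real
  show "(\<lambda>n. indicator (?S n) x *\<^sub>R \<phi> x) \<longlonglongrightarrow> indicator {0<..<1} x *\<^sub>R \<phi> x"
  proof (rule tendsto_eventually, cases "x \<in> {0<..<1}")
    case True
    then obtain N where "\<And>n. N \<le> n \<Longrightarrow> x \<in> ?S n" using unit_interval_exhaustion by blast
    then have "\<And>n. N \<le> n \<Longrightarrow> indicator (?S n) x *\<^sub>R \<phi> x = indicator {0<..<1} x *\<^sub>R \<phi> x"
      using True by (simp only: indicator_simps)
    then show "\<forall>\<^sub>F n in sequentially. indicator (?S n) x *\<^sub>R \<phi> x = indicator {0<..<1} x *\<^sub>R \<phi> x"
      unfolding eventually_sequentially by blast
  next
    case False
    have "x \<notin> ?S n" for n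
    proof
      assume "x \<in> ?S n"
      moreover have "0 < 1 / (real n + 2)" by simp
      ultimately have "x \<in> {0<..<1}" unfolding atLeastAtMost_iff greaterThanLessThan_iff by linarith
      with False show False by simp
    qed
    then show "\<forall>\<^sub>F n in sequentially. indicator (?S n) x *\<^sub>R \<phi> x = indicator {0<..<1} x *\<^sub>R \<phi> x"
      using False by (intro always_eventually allI) (simp only: indicator_simps not_False_eq_True scaleR_zero_left)
  qed
qed

section \<open>Control by the density of the Sobolev norm\<close>

lemma H1_density_nonneg: "0 \<le> r \<Longrightarrow> 0 \<le> H1_density k \<phi> r"
  by (simp add: H1_density_def)

lemma H1_has_weak_deriv: "\<phi> \<in> H1 k \<Longrightarrow> has_weak_deriv \<phi> (weak_deriv \<phi>)"
proof -
  assume "\<phi> \<in> H1 k"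
  then obtain g where "has_weak_deriv \<phi> g" unfolding H1_def by blast
  then show ?thesis unfolding weak_deriv_def by (rule someI[where P = "has_weak_deriv \<phi>"])
qed

lemma cmod_weak_deriv_le:
  assumes "0 < r"
  shows "cmod (weak_deriv \<phi> r) \<le> sqrt (H1_density k \<phi> r / r)"
  by (rule real_le_rsqrt) (use assms in \<open>simp add: H1_density_def\<close>)

text \<open>A nonzero integer has square at least 1, so the angular part of the density dominates
  \<open>(cmod (\<phi> r))\<^sup>2 / r\<close> with constant 1. This is what makes the final
  constant independent of \<open>k\<close>.\<close>

lemma cmod_le_H1_density:
  assumes "0 < r" "k \<noteq> 0"
  shows "cmod (\<phi> r) \<le> sqrt (H1_density k \<phi> r * r)"
proof (rule real_le_rsqrt)
  have "1 \<le> \<bar>k\<bar>" using assms by linarith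
  then have "1 \<le> (real_of_int k)\<^sup>2"
    by (metis of_int_1_le_iff of_int_abs one_le_power power2_abs)
  then have "(cmod (\<phi> r))\<^sup>2 \<le> (real_of_int k)\<^sup>2 * (cmod (\<phi> r))\<^sup>2"
    by (simp add: mult_le_cancel_right1)
  also have "\<dots> \<le> H1_density k \<phi> r * r"
    using assms by (simp add: H1_density_def field_simps power2_eq_square)
  finally show "(cmod (\<phi> r))\<^sup>2 \<le> H1_density k \<phi> r * r" .
qed

text \<open>Away from 0 the weight \<open>r\<close> is bounded below: the derivative is at most
  \<open>sqrt (H1_density k \<phi> r / r)\<close>, hence at most
  \<open>1 + H1_density k \<phi> r / a\<close>, which is integrable up to 1.\<close>

lemma H1_weak_deriv_integrable:
  assumes \<phi>: "\<phi> \<in> H1 k" and a: "0 < a"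
  shows "set_integrable lebesgue {a..1} (weak_deriv \<phi>)"
proof -
  have m: "set_borel_measurable lebesgue {a..<1} (weak_deriv \<phi>)"
    using H1_has_weak_deriv[OF \<phi>] a
    by (intro set_borel_measurable_subset[OF locally_integrable_measurable])
       (auto simp: has_weak_deriv_def)
  have dens: "set_integrable lebesgue {a..<1} (H1_density k \<phi>)"
    by (rule set_integrable_subset[of lebesgue "{0..<1}"]) (use \<phi> a in \<open>auto simp: H1_def\<close>)
  have "set_integrable lebesgue {a..1} (\<lambda>x. 1 :: real)"
    by (rule absolutely_integrable_continuous_real) auto
  then have one: "set_integrable lebesgue {a..<1} (\<lambda>x. 1 :: real)"
    by (rule set_integrable_subset) auto
  have "set_integrable lebesgue {a..<1} (weak_deriv \<phi>)"
  proof (rule set_integrable_bound[OF _ m])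
    show "set_integrable lebesgue {a..<1} (\<lambda>r. 1 + H1_density k \<phi> r / a)"
      using one dens by (intro set_integral_add) auto
    show "AE r in lebesgue. r \<in> {a..<1} \<longrightarrow> norm (weak_deriv \<phi> r) \<le> norm (1 + H1_density k \<phi> r / a)"
    proof (intro AE_I2 impI)
      fix r assume r: "r \<in> {a..<1}"
      define y where "y = H1_density k \<phi> r"
      have y: "0 \<le> y" using r a by (auto simp: y_def intro: H1_density_nonneg)
      have "cmod (weak_deriv \<phi> r) \<le> sqrt (y / r * 1)"
        using cmod_weak_deriv_le[of r \<phi> k] r a by (simp add: y_def)
      also have "\<dots> \<le> y / r + 1"
      proof -
        have "0 \<le> y / r" using y r a by simp
        then have "0 \<le> sqrt (y / r)" "2 * sqrt (y / r) \<le> y / r + 1"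
          using arith_geo_mean_sqrt[of "y / r" 1] by simp_all
        then have "sqrt (y / r) \<le> y / r + 1" by linarith
        then show ?thesis by simp
      qed
      also have "y / r \<le> y / a" using y r a by (auto intro: divide_left_mono)
      finally show "norm (weak_deriv \<phi> r) \<le> norm (1 + H1_density k \<phi> r / a)"
        using y a by (simp add: y_def)
    qed
  qed
  then show ?thesis
    by (subst set_integrable_discrete_difference[where X = "{1}" and B = "{a..<1}"]) auto
qed

lemma H1_AC_representative:
  assumes "\<phi> \<in> H1 k"
  obtains F where "\<And>a. 0 < a \<Longrightarrow> AC_from a F (weak_deriv \<phi>)"
    "AE r\<in>{0<..<1} in lebesgue. \<phi> r = F r"
  using weak_deriv_AC_representative[OF H1_has_weak_deriv[OF assms] H1_weak_deriv_integrable[OF assms]]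
  by blast

lemma H1_product_density:
  assumes \<phi>: "\<phi> \<in> H1 k" and \<eta>: "\<eta> \<in> H1 k"
  shows "set_integrable lebesgue {0..<1} (\<lambda>r. sqrt (H1_density k \<phi> r * H1_density k \<eta> r))"
    and "(LINT r:{0..<1}|lebesgue. sqrt (H1_density k \<phi> r * H1_density k \<eta> r)) \<le> H1_norm k \<phi> * H1_norm k \<eta>"
proof -
  \<comment> \<open>The density carries a factor \<open>r\<close> and may be negative for negative
    \<open>r\<close>; cutting off makes both functions nonnegative on the whole line.\<close>
  define P Q where "P r = indicator {0..<1} r *\<^sub>R H1_density k \<phi> r"
    and "Q r = indicator {0..<1} r *\<^sub>R H1_density k \<eta> r" for r
  have P: "integrable lebesgue P" and Q: "integrable lebesgue Q"
    using \<phi> \<eta> by (simp_all add: P_def[abs_def] Q_def[abs_def] H1_def set_integrable_def)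
  have nonneg: "0 \<le> P r" "0 \<le> Q r" for r
    by (auto simp: P_def Q_def indicator_def intro: H1_density_nonneg)
  have eq: "indicator {0..<1} r *\<^sub>R sqrt (H1_density k \<phi> r * H1_density k \<eta> r) = sqrt (P r * Q r)" for r
    by (simp add: P_def Q_def indicator_def)
  show "set_integrable lebesgue {0..<1} (\<lambda>r. sqrt (H1_density k \<phi> r * H1_density k \<eta> r))"
    unfolding set_integrable_def eq by (rule Cauchy_Schwarz_sqrt_integral(1)[OF P Q nonneg])
  show "(LINT r:{0..<1}|lebesgue. sqrt (H1_density k \<phi> r * H1_density k \<eta> r)) \<le> H1_norm k \<phi> * H1_norm k \<eta>"
    using Cauchy_Schwarz_sqrt_integral(2)[OF P Q nonneg]
    unfolding set_lebesgue_integral_def eq H1_norm_def by (simp add: P_def[abs_def] Q_def[abs_def])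
qed

section \<open>The oscillatory integral\<close>

lemma set_integral_norm_le_AE:
  fixes f :: "real \<Rightarrow> 'b::euclidean_space" and g :: "real \<Rightarrow> real"
  assumes f: "set_integrable lebesgue A f" and g: "set_integrable lebesgue B g"
    and A: "A \<in> sets lebesgue" "A \<subseteq> B"
    and le: "AE x\<in>A in lebesgue. norm (f x) \<le> g x" and nonneg: "\<And>x. x \<in> B \<Longrightarrow> 0 \<le> g x"
  shows "norm (LINT x:A|lebesgue. f x) \<le> (LINT x:B|lebesgue. g x)"
proof -
  have "norm (LINT x:A|lebesgue. f x) \<le> (LINT x|lebesgue. norm (indicator A x *\<^sub>R f x))"
    unfolding set_lebesgue_integral_def by (rule integral_norm_bound)
  also have "\<dots> \<le> (LINT x|lebesgue. indicator B x *\<^sub>R g x)"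
  proof (rule integral_mono_AE)
    show "integrable lebesgue (\<lambda>x. norm (indicator A x *\<^sub>R f x))" "integrable lebesgue (\<lambda>x. indicator B x *\<^sub>R g x)"
      using f g by (simp_all only: set_integrable_def integrable_norm)
    show "AE x in lebesgue. norm (indicator A x *\<^sub>R f x) \<le> indicator B x *\<^sub>R g x"
      using le
    proof eventually_elim
      case (elim x)
      then show ?case using nonneg[of x] A by (cases "x \<in> A"; cases "x \<in> B") auto
    qed
  qed
  finally show ?thesis by (simp only: set_lebesgue_integral_def)
qed

text \<open>In the application \<open>h\<close> is the representative of
  \<open>f_in * cnj \<eta>\<close>, \<open>w\<close> its derivative, \<open>D\<close> the geometric
  mean of the two densities, and \<open>\<kappa>\<close> is \<open>k * t\<close>. Every estimate is
  expressed through the integral of \<open>D\<close>, so the Sobolev norms enter only at the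
  end.\<close>

locale dominated_AC =
  fixes h w :: "real \<Rightarrow> complex" and D :: "real \<Rightarrow> real" and \<alpha> \<kappa> :: real
  assumes \<alpha>: "1 \<le> \<alpha>"
    and AC: "\<And>a. 0 < a \<Longrightarrow> AC_from a h w"
    and D: "set_integrable lebesgue {0..1} D" and D_nonneg: "\<And>r. r \<in> {0..1} \<Longrightarrow> 0 \<le> D r"
    and h_le: "AE r\<in>{0..1} in lebesgue. cmod (h r) \<le> r * D r"
    and w_le: "AE r\<in>{0..1} in lebesgue. cmod (w r) \<le> 2 * D r"
begin

definition mass :: real where "mass = (LINT r:{0..1}|lebesgue. D r)"

definition osc :: "real \<Rightarrow> complex" where "osc r = exp (- (\<i> * of_real \<kappa> * of_real (r powr \<alpha>)))"

lemma norm_osc [simp]: "cmod (osc r) = 1"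
proof -
  have "osc r = exp (\<i> * of_real (- \<kappa> * r powr \<alpha>))" by (simp add: osc_def mult.assoc)
  then show ?thesis by (simp only: norm_exp_i_times)
qed

lemma continuous_osc: "0 < a \<Longrightarrow> continuous_on {a..b} osc"
  unfolding osc_def using \<alpha> by (intro continuous_intros) auto

lemma mass_nonneg: "0 \<le> mass"
  unfolding mass_def set_lebesgue_integral_def
  by (rule integral_nonneg_AE) (auto simp: indicator_def D_nonneg)

lemma D_scale: "set_integrable lebesgue {0..1} (\<lambda>r. c * D r)" "(LINT r:{0..1}|lebesgue. c * D r) = c * mass"
  using D by (auto simp: mass_def)

lemma bound_by_mass:
  fixes f :: "real \<Rightarrow> complex"
  assumes f: "set_integrable lebesgue {a..b} f" and ab: "0 \<le> a" "b \<le> 1" and c: "0 \<le> c"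
    and le: "AE r\<in>{0..1} in lebesgue. r \<in> {a..b} \<longrightarrow> cmod (f r) \<le> c * D r"
  shows "cmod (LINT r:{a..b}|lebesgue. f r) \<le> c * mass"
proof -
  have "cmod (LINT r:{a..b}|lebesgue. f r) \<le> (LINT r:{0..1}|lebesgue. c * D r)"
  proof (rule set_integral_norm_le_AE[OF f D_scale(1)])
    show "AE r\<in>{a..b} in lebesgue. norm (f r) \<le> c * D r"
      using le by eventually_elim (use ab in auto)
  qed (use ab c D_nonneg in auto)
  then show ?thesis by (simp only: D_scale(2))
qed

lemma cmod_diff_le: "0 < r \<Longrightarrow> r \<le> 1 \<Longrightarrow> cmod (h 1 - h r) \<le> 2 * mass"
proof -
  assume r: "0 < r" "r \<le> 1"
  have "AE x\<in>{0..1} in lebesgue. x \<in> {r..1} \<longrightarrow> cmod (w x) \<le> 2 * D x"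
    using w_le by eventually_elim blast
  then have "cmod (LINT x:{r..1}|lebesgue. w x) \<le> 2 * mass"
    using r by (intro bound_by_mass[OF AC_from_set_integrable[OF AC[OF r(1)]]]) auto
  then show ?thesis
    using AC_from_integral[OF AC[OF r(1)], of r] r by simp
qed

text \<open>Averaging over \<open>{1/2..1}\<close> replaces the choice of a point where \<open>h\<close> is small.\<close>

lemma cmod_h1_le: "cmod (h 1) \<le> 4 * mass"
proof -
  have const: "set_integrable lebesgue {1/2..1::real} (\<lambda>r. c)" for c :: real
    by (rule absolutely_integrable_continuous_real) auto
  have Dhalf: "set_integrable lebesgue {1/2..1::real} D"
    by (rule set_integrable_subset[OF D]) auto
  have "(LINT r:{1/2..1::real}|lebesgue. cmod (h 1) - 2 * mass) \<le> (LINT r:{1/2..1::real}|lebesgue. D r)"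
  proof (rule set_integral_mono_AE[OF const Dhalf])
    show "AE r\<in>{1/2..1::real} in lebesgue. cmod (h 1) - 2 * mass \<le> D r"
      using h_le
    proof eventually_elim
      case (elim r)
      show ?case
      proof
        assume r: "r \<in> {1/2..1::real}"
        have "cmod (h 1) \<le> cmod (h 1 - h r) + cmod (h r)"
          using norm_triangle_ineq[of "h 1 - h r" "h r"] by simp
        moreover have "cmod (h 1 - h r) \<le> 2 * mass" using r by (intro cmod_diff_le) auto
        moreover have "cmod (h r) \<le> r * D r" using elim r by auto
        moreover have "r * D r \<le> D r" using r D_nonneg[of r] by (auto intro: mult_left_le_one_le)
        ultimately show "cmod (h 1) - 2 * mass \<le> D r" by linarith
      qed
    qed
  qed
  moreover have "(LINT r:{1/2..1::real}|lebesgue. cmod (h 1) - 2 * mass) = (cmod (h 1) - 2 * mass) / 2"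
    by (subst set_integral_const) auto
  moreover have "(LINT r:{1/2..1::real}|lebesgue. D r) \<le> mass"
  proof -
    have "norm (LINT r:{1/2..1::real}|lebesgue. D r) \<le> mass"
      unfolding mass_def by (rule set_integral_norm_le_AE[OF Dhalf D]) (use D_nonneg in auto)
    then show ?thesis by simp
  qed
  \<comment> \<open>The interval has length 1/2, so \<open>cmod (h 1)\<close> is at most
    \<open>2 * mass\<close> from the oscillation of \<open>h\<close> plus \<open>2 * mass\<close>
    from the average of \<open>D\<close>.\<close>
  ultimately have "(cmod (h 1) - 2 * mass) / 2 \<le> mass" by (metis order_trans)
  then show ?thesis by simp
qed

lemma cmod_h_le: "0 < r \<Longrightarrow> r \<le> 1 \<Longrightarrow> cmod (h r) \<le> 6 * mass"
  using cmod_diff_le[of r] cmod_h1_le norm_triangle_ineq2[of "h r" "h 1"]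
  by (simp add: norm_minus_commute)

text \<open>The integrand is continuous on each \<open>{p..1}\<close> with \<open>p > 0\<close>,
  hence measurable, and it is dominated by \<open>D\<close> since \<open>cmod (h r) * r\<close> is
  at most \<open>r * r * D r\<close>.\<close>

lemma integrand_integrable: "set_integrable lebesgue {0..1} (\<lambda>r. osc r * h r * of_real r)"
proof -
  let ?f = "\<lambda>r. osc r * h r * of_real r"
  have "set_integrable lebesgue {0<..<1} ?f"
  proof (rule set_integrable_bound)
    show "set_integrable lebesgue {0<..<1} D"
      by (rule set_integrable_subset[OF D]) auto
    have cont: "continuous_on {p..1} ?f" if "0 < p" for p
      using that by (intro continuous_intros continuous_osc AC_from_continuous[OF AC]) auto
    have "locally_integrable ?f"
      unfolding locally_integrable_def
    proof (intro allI impI)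
      fix p q :: real assume "0 < p" "q < 1"
      then show "set_integrable lebesgue {p..q} ?f"
        by (intro absolutely_integrable_continuous_real continuous_on_subset[OF cont[of p]]) auto
    qed
    then show "set_borel_measurable lebesgue {0<..<1} ?f"
      by (rule locally_integrable_measurable)
    show "AE r in lebesgue. r \<in> {0<..<1} \<longrightarrow> norm (osc r * h r * of_real r) \<le> norm (D r)"
      using h_le
    proof eventually_elim
      case (elim r)
      show ?case
      proof
        assume "r \<in> {0<..<1}"
        then have r: "r \<in> {0..1}" by auto
        have "cmod (h r) * r \<le> (r * D r) * r" using elim r by (auto intro: mult_right_mono)
        also have "\<dots> = (r * r) * D r" by simp
        also have "\<dots> \<le> D r"
          using r D_nonneg[OF r] by (auto intro!: mult_left_le_one_le mult_le_one)
        finally show "norm (osc r * h r * of_real r) \<le> norm (D r)"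
          using r by (simp add: norm_mult)
      qed
    qed
  qed
  then show ?thesis
    by (subst set_integrable_discrete_difference[where X = "{0, 1}" and B = "{0<..<1}"]) auto
qed

text \<open>The oscillation is discarded; one power of \<open>\<delta>\<close> comes from the bound
  on \<open>h\<close> and the other from the weight \<open>r\<close> of the measure.\<close>

lemma integral_near_0:
  assumes "0 \<le> \<delta>" "\<delta> \<le> 1"
  shows "cmod (LINT r:{0..\<delta>}|lebesgue. osc r * h r * of_real r) \<le> \<delta>\<^sup>2 * mass"
proof (rule bound_by_mass)
  show "set_integrable lebesgue {0..\<delta>} (\<lambda>r. osc r * h r * of_real r)"
    by (rule set_integrable_subset[OF integrand_integrable]) (use assms in auto)
  show "AE r\<in>{0..1} in lebesgue. r \<in> {0..\<delta>} \<longrightarrow> cmod (osc r * h r * of_real r) \<le> \<delta>\<^sup>2 * D r"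
    using h_le
  proof eventually_elim
    case (elim r)
    show ?case
    proof (intro impI)
      assume r: "r \<in> {0..1}" "r \<in> {0..\<delta>}"
      have "cmod (h r) * r \<le> (r * D r) * r" using elim r by (auto intro: mult_right_mono)
      also have "\<dots> = r\<^sup>2 * D r" by (simp add: power2_eq_square)
      also have "\<dots> \<le> \<delta>\<^sup>2 * D r"
        using r D_nonneg by (auto intro!: mult_right_mono power_mono)
      finally show "cmod (osc r * h r * of_real r) \<le> \<delta>\<^sup>2 * D r"
        using r by (simp add: norm_mult)
    qed
  qed
qed (use assms in auto)

text \<open>One integration by parts: the product rule for \<open>K * h\<close> expresses
  \<open>c\<close> times the integral through boundary terms and integrals of \<open>K * w\<close>
  and \<open>L * h\<close>. In the constant, 14 is 6 + 6 from the boundary values of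
  \<open>h\<close> and 2 from the bound on \<open>w\<close>; the lower order term \<open>L\<close>
  contributes \<open>\<bar>2 - \<alpha>\<bar>\<close>.\<close>

lemma integral_away_from_0:
  assumes \<delta>: "0 < \<delta>" "\<delta> \<le> 1"
  shows "\<bar>\<kappa>\<bar> * cmod (LINT r:{\<delta>..1}|lebesgue. osc r * h r * of_real r)
    \<le> (14 + \<bar>2 - \<alpha>\<bar>) * max 1 (\<delta> powr (2 - \<alpha>)) * mass"
proof -
  define X where "X = max 1 (\<delta> powr (2 - \<alpha>))"
  have X: "0 \<le> X" by (simp add: X_def)
  \<comment> \<open>The power is increasing or decreasing in \<open>r\<close> according to the sign
    of \<open>2 - \<alpha>\<close>, so it is largest at 1 or at \<open>\<delta>\<close>.\<close>
  have powr_le: "r powr (2 - \<alpha>) \<le> X" if r: "\<delta> \<le> r" "r \<le> 1" for r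
  proof (cases "\<alpha> \<le> 2")
    case True
    then have "r powr (2 - \<alpha>) \<le> 1 powr (2 - \<alpha>)" using \<delta> r by (intro powr_mono2) auto
    then show ?thesis by (simp add: X_def)
  next
    case False
    then have "r powr (2 - \<alpha>) \<le> \<delta> powr (2 - \<alpha>)" using \<delta> r by (intro powr_mono2') auto
    then show ?thesis by (simp add: X_def)
  qed
  \<comment> \<open>up to lower order terms, \<open>K'\<close> is the constant \<open>c\<close> times the weight \<open>osc r * r\<close> of the integrand\<close>
  define K where "K r = osc r * of_real (r powr (2 - \<alpha>))" for r
  define L where "L r = osc r * of_real ((2 - \<alpha>) * r powr (1 - \<alpha>))" for r
  define c where "c = - (\<i> * of_real \<kappa> * of_real \<alpha>)"
  have Kle: "cmod (K r) \<le> X" if "\<delta> \<le> r" "r \<le> 1" for r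
    using powr_le[OF that] by (simp add: K_def norm_mult)
  have cont: "continuous_on {\<delta>..1} osc" "continuous_on {\<delta>..1} (\<lambda>r. r powr a)" for a
    using \<delta> by (intro continuous_osc continuous_intros; auto)+
  have ACK: "AC_from \<delta> K (\<lambda>r. c * (osc r * of_real r) + L r)"
  proof (rule AC_from_C1)
    fix r assume "r \<in> {\<delta>..1}"
    then have r: "0 < r" using \<delta> by auto
    have 1: "((\<lambda>x. of_real (x powr p)) has_vector_derivative of_real (p * r powr (p - 1))) (at r within {\<delta>..1})" for p
      using r has_real_derivative_powr[OF r, of p]
      by (intro has_vector_derivative_of_real)
         (auto simp: has_real_derivative_iff_has_vector_derivative intro: has_vector_derivative_at_within)
    have "((\<lambda>x. - (\<i> * of_real \<kappa> * of_real (x powr \<alpha>))) has_vector_derivative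
        - (\<i> * of_real \<kappa> * of_real (\<alpha> * r powr (\<alpha> - 1)))) (at r within {\<delta>..1})"
      by (intro has_vector_derivative_minus has_vector_derivative_mult_right 1)
    from field_vector_diff_chain_within[OF this has_field_derivative_at_within[OF DERIV_exp]]
    have 2: "(osc has_vector_derivative
        - (\<i> * of_real \<kappa> * of_real (\<alpha> * r powr (\<alpha> - 1))) * osc r) (at r within {\<delta>..1})"
      unfolding osc_def[abs_def] o_def .
    \<comment> \<open>This fixes the exponent \<open>2 - \<alpha>\<close> in \<open>K\<close>: times
      the factor \<open>r powr (\<alpha> - 1)\<close> from differentiating the phase it gives the
      weight \<open>r\<close>.\<close>
    have 3: "of_real (r powr (\<alpha> - 1)) * of_real (r powr (2 - \<alpha>)) = (of_real r :: complex)"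
      using r by (simp add: powr_add[symmetric] flip: of_real_mult)
    have "osc r * of_real ((2 - \<alpha>) * r powr (2 - \<alpha> - 1))
        + - (\<i> * of_real \<kappa> * of_real (\<alpha> * r powr (\<alpha> - 1))) * osc r * of_real (r powr (2 - \<alpha>))
      = L r - \<i> * of_real \<kappa> * of_real \<alpha> * osc r * (of_real (r powr (\<alpha> - 1)) * of_real (r powr (2 - \<alpha>)))"
      by (simp add: L_def)
    also have "\<dots> = c * (osc r * of_real r) + L r"
      unfolding 3 by (simp add: c_def)
    finally show "(K has_vector_derivative c * (osc r * of_real r) + L r) (at r within {\<delta>..1})"
      using has_vector_derivative_mult[OF 2 1[of "2 - \<alpha>"]] unfolding K_def[abs_def] by simp
  next
    show "continuous_on {\<delta>..1} (\<lambda>r. c * (osc r * of_real r) + L r)"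
      unfolding L_def using \<delta> by (intro continuous_intros cont) auto
  qed
  note hc = AC_from_continuous[OF AC[OF \<delta>(1)]]
  note w = AC_from_set_integrable[OF AC[OF \<delta>(1)]]
  have i1: "set_integrable lebesgue {\<delta>..1} (\<lambda>r. K r * w r)"
    by (rule set_integrable_continuous_mult[OF AC_from_continuous[OF ACK] w])
  have i2: "set_integrable lebesgue {\<delta>..1} (\<lambda>r. L r * h r)"
    unfolding L_def using \<delta>
    by (intro absolutely_integrable_continuous_real continuous_intros cont hc) auto
  have i3: "set_integrable lebesgue {\<delta>..1} (\<lambda>r. osc r * h r * of_real r)"
    by (intro absolutely_integrable_continuous_real continuous_intros cont hc)
  define I where "I = (LINT r:{\<delta>..1}|lebesgue. osc r * h r * of_real r)"
  have "K 1 * h 1 - K \<delta> * h \<delta>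
      = (LINT r:{\<delta>..1}|lebesgue. K r * w r + (c * (osc r * of_real r) + L r) * h r)"
    using AC_from_integral[OF AC_from_mult[OF ACK AC[OF \<delta>(1)]], where r = \<delta>] \<delta> by simp
  also have "\<dots> = (LINT r:{\<delta>..1}|lebesgue. K r * w r + (c * (osc r * h r * of_real r) + L r * h r))"
    by (simp add: algebra_simps)
  also have "\<dots> = (LINT r:{\<delta>..1}|lebesgue. K r * w r) + (c * I + (LINT r:{\<delta>..1}|lebesgue. L r * h r))"
    using i1 i2 i3 by (simp only: set_integral_add set_integrable_mult_right set_integral_mult_right I_def)
  finally have "c * I = (K 1 * h 1 - K \<delta> * h \<delta>) - (LINT r:{\<delta>..1}|lebesgue. K r * w r)
      - (LINT r:{\<delta>..1}|lebesgue. L r * h r)"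
    by (simp add: algebra_simps)
  then have "cmod (c * I) \<le> cmod (K 1 * h 1) + cmod (K \<delta> * h \<delta>)
      + cmod (LINT r:{\<delta>..1}|lebesgue. K r * w r) + cmod (LINT r:{\<delta>..1}|lebesgue. L r * h r)"
    by (smt (verit) norm_triangle_ineq4)
  moreover have "cmod (K r * h r) \<le> X * (6 * mass)" if "\<delta> \<le> r" "r \<le> 1" for r
    using that \<delta> Kle[OF that] cmod_h_le[of r] X unfolding norm_mult by (intro mult_mono) auto
  from this[of 1] this[of \<delta>] have "cmod (K 1 * h 1) \<le> 6 * X * mass" "cmod (K \<delta> * h \<delta>) \<le> 6 * X * mass"
    using \<delta> by (auto simp: mult_ac)
  moreover have "cmod (LINT r:{\<delta>..1}|lebesgue. K r * w r) \<le> 2 * X * mass"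
  proof (rule bound_by_mass[OF i1])
    show "AE r\<in>{0..1} in lebesgue. r \<in> {\<delta>..1} \<longrightarrow> cmod (K r * w r) \<le> 2 * X * D r"
      using w_le
    proof eventually_elim
      case (elim r)
      show ?case
      proof (intro impI)
        assume r: "r \<in> {0..1}" "r \<in> {\<delta>..1}"
        then have "cmod (K r) * cmod (w r) \<le> X * (2 * D r)"
          using elim Kle X by (intro mult_mono) auto
        then show "cmod (K r * w r) \<le> 2 * X * D r" by (simp add: norm_mult mult_ac)
      qed
    qed
  qed (use \<delta> X in auto)
  moreover have "cmod (LINT r:{\<delta>..1}|lebesgue. L r * h r) \<le> \<bar>2 - \<alpha>\<bar> * X * mass"
  proof (rule bound_by_mass[OF i2])
    show "AE r\<in>{0..1} in lebesgue. r \<in> {\<delta>..1} \<longrightarrow> cmod (L r * h r) \<le> \<bar>2 - \<alpha>\<bar> * X * D r"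
      using h_le
    proof eventually_elim
      case (elim r)
      show ?case
      proof (intro impI)
        assume r: "r \<in> {0..1}" "r \<in> {\<delta>..1}"
        then have r0: "0 < r" using \<delta> by auto
        have "cmod (L r * h r) = \<bar>2 - \<alpha>\<bar> * r powr (1 - \<alpha>) * cmod (h r)"
          by (simp add: L_def norm_mult abs_mult del: of_real_mult)
        \<comment> \<open>The factor \<open>r\<close> in the bound on \<open>h\<close> raises the
          power from \<open>1 - \<alpha>\<close> to \<open>2 - \<alpha>\<close>, which
          \<open>X\<close> controls.\<close>
        also have "\<dots> \<le> \<bar>2 - \<alpha>\<bar> * r powr (1 - \<alpha>) * (r * D r)"
          using elim r by (intro mult_left_mono) auto
        also have "\<dots> = \<bar>2 - \<alpha>\<bar> * (r powr (1 - \<alpha>) * r powr 1) * D r"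
          using r0 by simp
        also have "\<dots> = \<bar>2 - \<alpha>\<bar> * r powr (2 - \<alpha>) * D r"
          unfolding powr_add[symmetric] by simp
        also have "\<dots> \<le> \<bar>2 - \<alpha>\<bar> * X * D r"
          using r D_nonneg powr_le by (intro mult_right_mono mult_left_mono) auto
        finally show "cmod (L r * h r) \<le> \<bar>2 - \<alpha>\<bar> * X * D r" .
      qed
    qed
  qed (use \<delta> X in auto)
  ultimately have "cmod (c * I) \<le> (14 + \<bar>2 - \<alpha>\<bar>) * X * mass"
    by (simp add: algebra_simps)
  \<comment> \<open>The modulus of \<open>c\<close> is
    \<open>\<alpha> * \<bar>\<kappa>\<bar>\<close>, and the factor \<alpha> may be dropped because
    it is at least 1.\<close>
  moreover have "\<bar>\<kappa>\<bar> * cmod I \<le> cmod (c * I)"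
  proof -
    have "cmod (c * I) = \<alpha> * (\<bar>\<kappa>\<bar> * cmod I)" using \<alpha> by (simp add: c_def norm_mult)
    then show ?thesis using \<alpha> mult_right_mono[of 1 \<alpha> "\<bar>\<kappa>\<bar> * cmod I"] by simp
  qed
  ultimately show ?thesis unfolding I_def X_def by linarith
qed

text \<open>For small \<open>\<kappa>\<close> the trivial bound by \<open>mass\<close> suffices, as
  the denominator is at most 2. Otherwise the integral is split at \<open>\<delta>\<close>; 15 is
  the constant 14 away from 0 plus 1 from the part near 0, and the factor 2 pays for replacing
  \<open>\<bar>\<kappa>\<bar>\<close> by \<open>1 + \<bar>\<kappa>\<bar>\<close>.\<close>

lemma oscillatory_integral_bound:
  "cmod (LINT r:{0..1}|lebesgue. osc r * h r * of_real r)
    \<le> 2 * (15 + \<bar>2 - \<alpha>\<bar>) / (1 + \<bar>\<kappa>\<bar>) powr (2 / max \<alpha> 2) * mass"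
proof -
  define p where "p = 2 / max \<alpha> 2"
  have p: "0 < p" "p \<le> 1" using \<alpha> by (auto simp: p_def field_simps)
  define C where "C = 15 + \<bar>2 - \<alpha>\<bar>"
  have C: "15 \<le> C" by (simp add: C_def)
  define J where "J = cmod (LINT r:{0..1}|lebesgue. osc r * h r * of_real r)"
  have two: "2 powr p \<le> (2::real)" using powr_mono[of p 1 "2::real"] p by simp
  have "J \<le> 2 * C / (1 + \<bar>\<kappa>\<bar>) powr p * mass"
  proof (cases "\<bar>\<kappa>\<bar> \<le> 1")
    case True
    have "(1 + \<bar>\<kappa>\<bar>) powr p \<le> 2 powr p" using True p by (intro powr_mono2) auto
    then have "(1 + \<bar>\<kappa>\<bar>) powr p \<le> 2 * C" using two C by linarith
    then have "1 \<le> 2 * C / (1 + \<bar>\<kappa>\<bar>) powr p" by (simp add: divide_simps)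
    moreover have "J \<le> mass" using integral_near_0[of 1] by (simp add: J_def)
    ultimately show ?thesis
      using mult_right_mono[of 1 "2 * C / (1 + \<bar>\<kappa>\<bar>) powr p" mass] mass_nonneg by simp
  next
    case False
    define l where "l = \<bar>\<kappa>\<bar>"
    have l: "1 < l" using False by (simp add: l_def)
    \<comment> \<open>balances the bound \<open>\<delta>\<^sup>2\<close> near \<open>0\<close> against \<open>\<delta> powr (2 - \<alpha>) / l\<close> away from it\<close>
    define \<delta> where "\<delta> = l powr (- p / 2)"
    have \<delta>: "0 < \<delta>" "\<delta> \<le> 1"
      using l p powr_mono[of "- p / 2" 0 l] by (auto simp: \<delta>_def)
    have sq: "\<delta>\<^sup>2 = l powr (- p)"
      using l by (simp add: \<delta>_def power2_eq_square powr_add[symmetric])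
    have X: "max 1 (\<delta> powr (2 - \<alpha>)) \<le> l * l powr (- p)"
    proof -
      have l1: "l * l powr (- p) = l powr (1 - p)" using l by (simp add: powr_diff powr_minus field_simps)
      have "1 \<le> l powr (1 - p)" using l p by (intro ge_one_powr_ge_zero) auto
      moreover have "\<delta> powr (2 - \<alpha>) \<le> l powr (1 - p)"
      proof -
        \<comment> \<open>If \<open>\<alpha> \<le> 2\<close> then \<open>p = 1\<close>, and the left
          side is nonpositive while the right side is 0. If \<open>\<alpha> > 2\<close> then
          \<open>p = 2 / \<alpha>\<close> and both sides equal \<open>1 - 2 / \<alpha>\<close>: the
          two parts balance exactly.\<close>
        have "- p / 2 * (2 - \<alpha>) \<le> 1 - p"
        proof (cases "\<alpha> \<le> 2")
          case True
          then show ?thesis by (simp add: p_def max_def)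
        next
          case False
          then show ?thesis by (simp add: p_def max_def field_simps)
        qed
        then show ?thesis unfolding \<delta>_def powr_powr using l by (intro powr_mono) auto
      qed
      ultimately show ?thesis by (simp add: l1)
    qed
    have J: "J \<le> cmod (LINT r:{0..\<delta>}|lebesgue. osc r * h r * of_real r)
        + cmod (LINT r:{\<delta>..1}|lebesgue. osc r * h r * of_real r)"
    proof -
      have i: "set_integrable lebesgue A (\<lambda>r. osc r * h r * of_real r)"
        if "A \<subseteq> {0..1}" "A \<in> sets lebesgue" for A
        using that by (intro set_integrable_subset[OF integrand_integrable])
      have "(LINT r:{0..\<delta>} \<union> {\<delta><..1}|lebesgue. osc r * h r * of_real r)
        = (LINT r:{0..\<delta>}|lebesgue. osc r * h r * of_real r) + (LINT r:{\<delta><..1}|lebesgue. osc r * h r * of_real r)"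
        using \<delta> by (intro set_integral_Un i) auto
      also have "{0..\<delta>} \<union> {\<delta><..1} = {0..1}" using \<delta> by auto
      also have "(LINT r:{\<delta><..1}|lebesgue. osc r * h r * of_real r) = (LINT r:{\<delta>..1}|lebesgue. osc r * h r * of_real r)"
        by (rule set_integral_discrete_difference[of "{\<delta>}"]) auto
      finally show ?thesis unfolding J_def by (simp only: norm_triangle_ineq)
    qed
    have "l * cmod (LINT r:{\<delta>..1}|lebesgue. osc r * h r * of_real r)
        \<le> (14 + \<bar>2 - \<alpha>\<bar>) * max 1 (\<delta> powr (2 - \<alpha>)) * mass"
      unfolding l_def by (rule integral_away_from_0[OF \<delta>])
    also have "\<dots> \<le> (14 + \<bar>2 - \<alpha>\<bar>) * (l * l powr (- p)) * mass"
      using X mass_nonneg by (intro mult_right_mono mult_left_mono) auto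
    also have "\<dots> = l * ((14 + \<bar>2 - \<alpha>\<bar>) * l powr (- p) * mass)" by simp
    finally have "cmod (LINT r:{\<delta>..1}|lebesgue. osc r * h r * of_real r)
        \<le> (14 + \<bar>2 - \<alpha>\<bar>) * l powr (- p) * mass"
      using l by simp
    then have J2: "J \<le> C * l powr (- p) * mass"
      using J integral_near_0[of \<delta>] \<delta> unfolding sq by (simp add: C_def algebra_simps)
    \<comment> \<open>Since \<open>l > 1\<close>, replacing \<open>l\<close> by \<open>1 + l\<close>
      costs only \<open>2 powr p\<close>, which is at most 2.\<close>
    have "(1 + l) powr p \<le> (2 * l) powr p" using l p by (intro powr_mono2) auto
    also have "\<dots> = 2 powr p * l powr p" using l by (simp add: powr_mult)
    also have "\<dots> \<le> 2 * l powr p" using two by (intro mult_right_mono) auto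
    finally have "l powr (- p) \<le> 2 / (1 + l) powr p"
      using l by (simp add: powr_minus field_simps)
    then have "C * l powr (- p) * mass \<le> C * (2 / (1 + l) powr p) * mass"
      using C mass_nonneg by (intro mult_right_mono mult_left_mono) auto
    with J2 show ?thesis by (simp add: l_def mult_ac)
  qed
  then show ?thesis by (simp add: J_def C_def p_def)
qed

end

section \<open>From the oscillatory integral to the dual norm\<close>

lemma AE_unit_interval_closure:
  "AE r\<in>{0<..<1} in lebesgue. P r \<Longrightarrow> AE r\<in>{0..1::real} in lebesgue. P r"
proof -
  assume P: "AE r\<in>{0<..<1} in lebesgue. P r"
  have "AE r in lebesgue. r \<notin> {0, 1 :: real}" by (rule AE_not_in) auto
  with P show ?thesis by eventually_elim auto
qed

text \<open>With densities \<open>P\<close> and \<open>Q\<close>, the functions are bounded by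
  \<open>sqrt (P * r)\<close> and \<open>sqrt (Q * r)\<close>, their derivatives by
  \<open>sqrt (P / r)\<close> and \<open>sqrt (Q / r)\<close>. Hence \<open>h\<close> gains a factor
  \<open>r\<close> over \<open>D\<close>, while in each of the two terms of \<open>w\<close> the
  powers of \<open>r\<close> cancel, which gives \<open>2 * D\<close>.\<close>

lemma H1_pairing_bound:
  fixes t :: real
  assumes \<alpha>: "1 \<le> \<alpha>" and k: "k \<noteq> 0" and \<phi>: "\<phi> \<in> H1 k" and \<eta>: "\<eta> \<in> H1 k"
    and f: "transport_solution \<alpha> k \<phi> f" and t: "0 \<le> t"
  shows "cmod (LINT r:{0..<1}|lebesgue. f t r * cnj (\<eta> r) * of_real r)
    \<le> 2 * (15 + \<bar>2 - \<alpha>\<bar>) / (1 + real_of_int \<bar>k\<bar> * t) powr (2 / max \<alpha> 2) * (H1_norm k \<phi> * H1_norm k \<eta>)"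
proof -
  obtain F where F: "\<And>a. 0 < a \<Longrightarrow> AC_from a F (weak_deriv \<phi>)" "AE r\<in>{0<..<1} in lebesgue. \<phi> r = F r"
    using H1_AC_representative[OF \<phi>] by metis
  obtain G where G: "\<And>a. 0 < a \<Longrightarrow> AC_from a G (weak_deriv \<eta>)" "AE r\<in>{0<..<1} in lebesgue. \<eta> r = G r"
    using H1_AC_representative[OF \<eta>] by metis
  define h where "h r = F r * cnj (G r)" for r
  define w where "w r = F r * cnj (weak_deriv \<eta> r) + weak_deriv \<phi> r * cnj (G r)" for r
  define D where "D r = sqrt (H1_density k \<phi> r * H1_density k \<eta> r)" for r
  have bounds: "AE r\<in>{0<..<1} in lebesgue. cmod (h r) \<le> r * D r \<and> cmod (w r) \<le> 2 * D r"
    using F(2) G(2)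
  proof eventually_elim
    case (elim r)
    show ?case
    proof
      assume r: "r \<in> {0<..<1}"
      then have r0: "0 < r" by simp
      define P Q where "P = H1_density k \<phi> r" and "Q = H1_density k \<eta> r"
      have PQ: "0 \<le> P" "0 \<le> Q" using r by (simp_all add: P_def Q_def H1_density_nonneg)
      have \<phi>r: "cmod (F r) \<le> sqrt (P * r)" "cmod (weak_deriv \<phi> r) \<le> sqrt (P / r)"
        using cmod_le_H1_density[OF r0 k, of \<phi>] cmod_weak_deriv_le[OF r0, of \<phi> k] elim r by (simp_all add: P_def)
      have \<eta>r: "cmod (G r) \<le> sqrt (Q * r)" "cmod (weak_deriv \<eta> r) \<le> sqrt (Q / r)"
        using cmod_le_H1_density[OF r0 k, of \<eta>] cmod_weak_deriv_le[OF r0, of \<eta> k] elim r by (simp_all add: Q_def)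
      have "cmod (F r) * cmod (G r) \<le> sqrt (P * r) * sqrt (Q * r)"
        using \<phi>r \<eta>r PQ r0 by (intro mult_mono) auto
      also have "\<dots> = r * sqrt (P * Q)"
        using r0 by (simp add: real_sqrt_mult)
      finally have 1: "cmod (h r) \<le> r * D r"
        by (simp add: h_def norm_mult D_def P_def Q_def)
      have "cmod (F r) * cmod (weak_deriv \<eta> r) \<le> sqrt (P * r) * sqrt (Q / r)"
        using \<phi>r \<eta>r PQ r0 by (intro mult_mono) auto
      also have "\<dots> = sqrt (P * Q)"
        using r0 by (simp add: real_sqrt_mult[symmetric])
      finally have 2: "cmod (F r * cnj (weak_deriv \<eta> r)) \<le> D r"
        by (simp add: norm_mult D_def P_def Q_def)
      have "cmod (weak_deriv \<phi> r) * cmod (G r) \<le> sqrt (P / r) * sqrt (Q * r)"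
        using \<phi>r \<eta>r PQ r0 by (intro mult_mono) auto
      also have "\<dots> = sqrt (P * Q)"
        using r0 by (simp add: real_sqrt_mult[symmetric])
      finally have 3: "cmod (weak_deriv \<phi> r * cnj (G r)) \<le> D r"
        by (simp add: norm_mult D_def P_def Q_def)
      have "cmod (w r) \<le> 2 * D r"
        using norm_triangle_ineq[of "F r * cnj (weak_deriv \<eta> r)" "weak_deriv \<phi> r * cnj (G r)"] 2 3
        by (simp add: w_def)
      with 1 show "cmod (h r) \<le> r * D r \<and> cmod (w r) \<le> 2 * D r" ..
    qed
  qed
  interpret dominated_AC h w D \<alpha> "of_int k * t"
  proof
    show "AC_from a h w" if "0 < a" for a
      using AC_from_mult[OF F(1)[OF that] AC_from_cnj[OF G(1)[OF that]]]
      by (simp add: h_def[abs_def] w_def[abs_def])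
    show "set_integrable lebesgue {0..1} D"
      using H1_product_density(1)[OF \<phi> \<eta>]
      by (subst set_integrable_discrete_difference[where X = "{1}" and B = "{0..<1}"]) (auto simp: D_def[abs_def])
    show "0 \<le> D r" if "r \<in> {0..1}" for r
      using that by (simp add: D_def H1_density_nonneg)
    show "AE r\<in>{0..1} in lebesgue. cmod (h r) \<le> r * D r" "AE r\<in>{0..1} in lebesgue. cmod (w r) \<le> 2 * D r"
      using AE_unit_interval_closure[OF bounds] by (auto elim: eventually_mono)
  qed (rule \<alpha>)
  have mass: "mass \<le> H1_norm k \<phi> * H1_norm k \<eta>"
  proof -
    have "mass = (LINT r:{0..<1}|lebesgue. D r)"
      unfolding mass_def by (rule set_integral_discrete_difference[of "{1}"]) auto
    then show ?thesis using H1_product_density(2)[OF \<phi> \<eta>] by (simp add: D_def[abs_def])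
  qed
  \<comment> \<open>The equation enters only here, through the explicit formula for its solutions,
    valid almost everywhere; integrability of the actual pairing is inherited from the
    representative.\<close>
  have eq: "AE r\<in>{0..1} in lebesgue. osc r * h r * of_real r = f t r * cnj (\<eta> r) * of_real r"
  proof (rule AE_unit_interval_closure)
    show "AE r\<in>{0<..<1} in lebesgue. osc r * h r * of_real r = f t r * cnj (\<eta> r) * of_real r"
      using F(2) G(2) transport_solution_unique[OF f]
    proof eventually_elim
      case (elim r)
      have osc: "osc r = exp (- (\<i> * of_int k * of_real (r powr \<alpha>) * of_real t))"
        unfolding osc_def of_real_mult of_real_of_int_eq by (simp only: mult_ac)
      show ?case unfolding osc h_def using elim t by (auto simp: mult_ac)
    qed
  qed
  have "(LINT r:{0..<1}|lebesgue. f t r * cnj (\<eta> r) * of_real r)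
      = (LINT r:{0..1}|lebesgue. f t r * cnj (\<eta> r) * of_real r)"
    by (rule set_integral_discrete_difference[of "{1}"]) auto
  also have "\<dots> = (LINT r:{0..1}|lebesgue. osc r * h r * of_real r)"
    by (rule AE_lebesgue_cong_set_integral(2)[OF integrand_integrable eq, symmetric])
  finally have "cmod (LINT r:{0..<1}|lebesgue. f t r * cnj (\<eta> r) * of_real r)
      \<le> 2 * (15 + \<bar>2 - \<alpha>\<bar>) / (1 + \<bar>of_int k * t\<bar>) powr (2 / max \<alpha> 2) * mass"
    using oscillatory_integral_bound by simp
  also have "\<dots> \<le> 2 * (15 + \<bar>2 - \<alpha>\<bar>) / (1 + \<bar>of_int k * t\<bar>) powr (2 / max \<alpha> 2) * (H1_norm k \<phi> * H1_norm k \<eta>)"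
    using mass by (intro mult_left_mono) auto
  finally show ?thesis using t by (simp add: abs_mult)
qed

theorem proposition5p1:
  fixes \<alpha> :: real
  assumes "1 \<le> \<alpha>"
  shows "\<exists>a>0. \<forall>k::int. k \<noteq> 0 \<longrightarrow>
    (\<forall>f_in\<in>H1 k. \<forall>f. transport_solution \<alpha> k f_in f \<longrightarrow>
      (\<forall>t\<ge>0. Hm1_norm k (f t)
         \<le> ennreal (a / (1 + real_of_int \<bar>k\<bar> * t) powr (2 / max \<alpha> 2) * H1_norm k f_in)))"
\<comment> \<open>The witness is the constant of the oscillatory integral bound, which depends on
  \<alpha> alone. Each pairing in the supremum has \<open>H1_norm k \<eta> = 1\<close>, so only the
  norm of the initial datum remains.\<close>
proof (intro exI[of _ "2 * (15 + \<bar>2 - \<alpha>\<bar>)"] conjI allI impI ballI)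
  fix k :: int and f_in f and t :: real
  assume k: "k \<noteq> 0" and f_in: "f_in \<in> H1 k" and f: "transport_solution \<alpha> k f_in f" and t: "0 \<le> t"
  show "Hm1_norm k (f t) \<le> ennreal (2 * (15 + \<bar>2 - \<alpha>\<bar>) /
      (1 + real_of_int \<bar>k\<bar> * t) powr (2 / max \<alpha> 2) * H1_norm k f_in)"
    unfolding Hm1_norm_def
  proof (rule SUP_least)
    fix \<eta> assume "\<eta> \<in> {\<eta> \<in> H1 k. H1_norm k \<eta> = 1}"
    then show "ennreal (cmod (LINT r:{0..<1}|lebesgue. f t r * cnj (\<eta> r) * of_real r))
      \<le> ennreal (2 * (15 + \<bar>2 - \<alpha>\<bar>) /
        (1 + real_of_int \<bar>k\<bar> * t) powr (2 / max \<alpha> 2) * H1_norm k f_in)"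
      using H1_pairing_bound[OF assms k f_in _ f t, of \<eta>] by (intro ennreal_leI) simp
  qed
qed (rule mult_pos_pos add_pos_nonneg | simp)+

end
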